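(* Let $\alpha>0$, let $\phi(z)=\phi(0)+\lambda z$ with $\phi(0),\lambda\in\mathbb C$, and let $\psi(z)=ce^{dz}$, where $c,d\in\mathbb C$ and $c\neq 0$. (i) For $0<m<1$, $C_{\psi,\phi}$ is compact on $F^2_{\alpha,m}(\mathbb C)$ if and only if $|\lambda|<1$ and $d=0$. (ii) For $m>1$, $C_{\psi,\phi}$ is compact on $F^2_{\alpha,m}(\mathbb C)$ if and only if $|\lambda|<1$.
   Context: For $m>0$ and $\alpha>0$, the weighted Fock space $F^2_{\alpha,m}(\mathbb C)$ is the Hilbert space of all entire functions on $\mathbb C$ that are square integrable with respect to the measure $d\mu_{\alpha,m}(z)=\frac{m\alpha^{2/m}}{2\pi\Gamma(2/m)}e^{-\alpha|z|^m}\,dA(z)$, where $dA$ is Lebesgue measure on $\mathbb C$ and $\Gamma$ is the Euler gamma function; its inner product is $\langle f,g\rangle_{\alpha,m}=\int_{\mathbb C} f\overline{g}\,d\mu_{\alpha,m}$ and its norm is $\|\cdot\|_{\alpha,m}$. For entire functions $\psi$ and $\phi$, the weighted composition operator is $C_{\psi,\phi}f=\psi\cdot(f\circ\phi)$. Saying that it is compact on $F^2_{\alpha,m}(\mathbb C)$ means that it maps $F^2_{\alpha,m}(\mathbb C)$ into itself and is a compact linear operator there. *)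

theory Defs
  imports "HOL-Analysis.Analysis"
begin

definition fock_measure :: "real \<Rightarrow> real \<Rightarrow> complex measure" where
  "fock_measure \<alpha> m =
     density lborel (\<lambda>z. ennreal (m * \<alpha> powr (2 / m) / (2 * pi * Gamma (2 / m)) *
                                  exp (- \<alpha> * norm z powr m)))"

definition fock_space :: "real \<Rightarrow> real \<Rightarrow> (complex \<Rightarrow> complex) set" where
  "fock_space \<alpha> m =
     {f. f holomorphic_on UNIV \<and> integrable (fock_measure \<alpha> m) (\<lambda>z. (norm (f z))\<^sup>2)}"

definition fock_inner :: "real \<Rightarrow> real \<Rightarrow> (complex \<Rightarrow> complex) \<Rightarrow> (complex \<Rightarrow> complex) \<Rightarrow> complex" where
  "fock_inner \<alpha> m f g = (LINT z|fock_measure \<alpha> m. f z * cnj (g z))"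

definition fock_norm :: "real \<Rightarrow> real \<Rightarrow> (complex \<Rightarrow> complex) \<Rightarrow> real" where
  "fock_norm \<alpha> m f = sqrt (Re (fock_inner \<alpha> m f f))"

lemma fock_norm_eq: "fock_norm \<alpha> m f = sqrt (LINT z|fock_measure \<alpha> m. (norm (f z))\<^sup>2)"
proof -
  have "fock_inner \<alpha> m f f = (LINT z|fock_measure \<alpha> m. complex_of_real ((norm (f z))\<^sup>2))"
    unfolding fock_inner_def by (simp only: complex_norm_square)
  then show ?thesis
    by (simp only: fock_norm_def integral_complex_of_real Re_complex_of_real)
qed

definition weighted_composition ::
  "(complex \<Rightarrow> complex) \<Rightarrow> (complex \<Rightarrow> complex) \<Rightarrow> (complex \<Rightarrow> complex) \<Rightarrow> complex \<Rightarrow> complex" where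
  "weighted_composition \<psi> \<phi> f = (\<lambda>z. \<psi> z * f (\<phi> z))"

text \<open>Compactness is expressed sequentially: every norm-bounded sequence in the space has a
  subsequence whose image converges in norm to an element of the space.\<close>

definition compact_on_fock ::
  "real \<Rightarrow> real \<Rightarrow> ((complex \<Rightarrow> complex) \<Rightarrow> complex \<Rightarrow> complex) \<Rightarrow> bool" where
  "compact_on_fock \<alpha> m T \<longleftrightarrow>
     (\<forall>f\<in>fock_space \<alpha> m. T f \<in> fock_space \<alpha> m) \<and>
     (\<forall>f\<in>fock_space \<alpha> m. \<forall>g\<in>fock_space \<alpha> m. T (\<lambda>z. f z + g z) = (\<lambda>z. T f z + T g z)) \<and>
     (\<forall>k. \<forall>f\<in>fock_space \<alpha> m. T (\<lambda>z. k * f z) = (\<lambda>z. k * T f z)) \<and>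
     (\<forall>F :: nat \<Rightarrow> complex \<Rightarrow> complex.
        (\<forall>n. F n \<in> fock_space \<alpha> m) \<and> (\<exists>B. \<forall>n. fock_norm \<alpha> m (F n) \<le> B) \<longrightarrow>
        (\<exists>g\<in>fock_space \<alpha> m. \<exists>r :: nat \<Rightarrow> nat. strict_mono r \<and>
           (\<lambda>n. fock_norm \<alpha> m (\<lambda>z. T (F (r n)) z - g z)) \<longlonglongrightarrow> 0))"

end

theory Submission
  imports Defs "HOL-Complex_Analysis.Complex_Analysis" "HOL-Real_Asymp.Real_Asymp"
begin

text \<open>
  The whole argument is driven by two size functions for evaluation at a point. Write \<open>a = \<phi> 0\<close> and
  \<open>T f z = c * exp (d * z) * f (a + l * z)\<close>.

  \<^emph>\<open>Sufficiency.\<close> The area mean value property bounds \<open>\<bar>f w\<bar>\<^sup>2\<close> by a constant times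
  \<open>exp (\<alpha> * (\<bar>w\<bar> + 1) powr m)\<close>, uniformly on bounded subsets of the space
  (\<open>fock_pointwise_bound\<close>). If \<open>\<bar>l\<bar> < 1\<close>, this crude bound at \<open>a + l * z\<close> is beaten by the
  weight at \<open>z\<close> with a margin of order \<open>\<bar>z\<bar> powr m\<close>, and for \<open>m > 1\<close> the margin also absorbs
  the factor \<open>exp (2 * \<bar>d\<bar> * \<bar>z\<bar>)\<close>. So one integrable function dominates
  \<open>\<bar>T f\<bar>\<^sup>2\<close> times the weight for all \<open>f\<close> in a ball. Montel's theorem extracts from a bounded sequence
  a pointwise convergent subsequence, and dominated convergence turns that into norm convergence of the
  images (\<open>compact_weighted_composition\<close>).

  \<^emph>\<open>The exponential factor when \<open>m < 1\<close>.\<close> The image of the constant \<open>1\<close> is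
  \<open>c * exp (d * z)\<close>, which for \<open>d \<noteq> 0\<close> grows too fast for the pointwise bound
  (\<open>exp_linear_in_fock_imp_constant\<close>).

  \<^emph>\<open>Necessity of \<open>\<bar>l\<bar> < 1\<close>.\<close> Let \<open>k \<bar>w\<bar>\<close> (\<open>fock_kernel_diag\<close>) be the value \<open>K w w\<close> of the
  reproducing kernel on the diagonal; since the weight is radial, it is the increasing power series
  \<open>\<Sum>n. \<bar>w\<bar> ^ (2 * n) / \<parallel>z ^ n\<parallel>\<^sup>2\<close>. Its root is the norm of the evaluation at \<open>w\<close>, and every
  fixed \<open>g\<close> satisfies \<open>g w = o (sqrt (k \<bar>w\<bar>))\<close> (\<open>fock_evaluation_bound\<close>,
  \<open>fock_little_o_kernel\<close>). If \<open>\<bar>l\<bar> \<ge> 1\<close>, there is a ray on which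
  \<open>\<bar>a + l * w\<bar> \<ge> \<bar>w\<bar>\<close> and \<open>\<bar>exp (d * w)\<bar> \<ge> 1\<close>: the first condition holds on the line
  where \<open>l * w\<close> is orthogonal to \<open>a\<close>, and \<open>Re (d * w)\<close> is nonnegative on one half of that
  line. Unit vectors that are nearly extremal for evaluation at \<open>a + l * w\<close> then have images of size at
  least \<open>\<bar>c\<bar> / 2 * sqrt (k \<bar>w\<bar>)\<close> at \<open>w\<close>. A norm limit of a subsequence of
  these images would be as large far out on the ray, contradicting the little-o estimate
  (\<open>compact_imp_contraction\<close>).
\<close>

(* Frees the infix dollar sign for vector components. *)
no_notation fps_nth (infixl "$" 75)

section \<open>Rotation invariance of planar Lebesgue measure\<close>

text \<open>The change of variables theorems for orthogonal maps speak about \<open>real ^ 2\<close>; this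
  carries them over to the complex plane.\<close>
lemma lborel_complex_eq_distr_vec:
  "(lborel :: complex measure) = distr (lborel :: (real^2) measure) borel (\<lambda>x. Complex (x $ 1) (x $ 2))"
proof (rule lborel_eqI)
  fix a b :: complex
  assume le: "\<And>i. i \<in> Basis \<Longrightarrow> a \<bullet> i \<le> b \<bullet> i"
  from this[of 1] this[of \<i>] have le: "Re a \<le> Re b" "Im a \<le> Im b"
    by (simp_all add: Basis_complex_def inner_complex_def)
  have [measurable]: "(\<lambda>x::real^2. Complex (x $ 1) (x $ 2)) \<in> borel_measurable borel"
    unfolding Complex_eq by (intro borel_measurable_continuous_onI continuous_intros)
  define p q :: "real^2" where "p = vector [Re a, Im a]" and "q = vector [Re b, Im b]"
  have "emeasure (distr lborel borel (\<lambda>x::real^2. Complex (x $ 1) (x $ 2))) (box a b)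
      = emeasure lborel (box p q)"
    by (subst emeasure_distr)
       (auto intro!: arg_cong2[where f=emeasure]
         simp: mem_box_cart p_def q_def forall_2 in_box_complex_iff)
  also have "\<dots> = (\<Prod>i\<in>Basis. (q - p) \<bullet> i)"
  proof (subst emeasure_lborel_box)
    fix i :: "real^2" assume "i \<in> Basis"
    then obtain k where "i = axis k 1" by (auto simp: Basis_vec_def)
    then show "p \<bullet> i \<le> q \<bullet> i"
      using le exhaust_2[of k] by (auto simp: p_def q_def inner_axis)
  qed simp
  also have "(\<Prod>i\<in>Basis. (q - p) \<bullet> i) = (\<Prod>i\<in>Basis. (b - a) \<bullet> i)"
    by (simp add: Basis_vec_def p_def q_def UNIV_2 inner_axis Basis_complex_def axis_eq_axis inner_complex_def)
  finally show "emeasure (distr lborel borel (\<lambda>x::real^2. Complex (x $ 1) (x $ 2))) (box a b)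
     = ennreal (\<Prod>i\<in>Basis. (b - a) \<bullet> i)" .
qed simp

lemma lborel_distr_orthogonal:
  fixes T :: "real^'n::{finite,wellorder} \<Rightarrow> real^'n::_"
  assumes T: "orthogonal_transformation T"
  shows "distr lborel borel T = lborel"
proof (rule lborel_eqI[symmetric])
  have [measurable]: "T \<in> borel_measurable borel"
    using T by (intro borel_measurable_continuous_onI linear_continuous_on)
       (simp add: orthogonal_transformation_def linear_linear)
  fix a b :: "real^'n::_"
  assume le: "\<And>i. i \<in> Basis \<Longrightarrow> a \<bullet> i \<le> b \<bullet> i"
  have T': "orthogonal_transformation (inv T)"
    using T by (rule orthogonal_transformation_inv)
  have eq: "T -` box a b = inv T ` box a b"
    using T by (simp add: bij_vimage_eq_inv_image orthogonal_transformation_bij)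
  have meas: "T -` box a b \<in> sets borel"
    using measurable_sets[of T borel borel "box a b"] by simp
  have "emeasure (distr lborel borel T) (box a b) = emeasure lebesgue (T -` box a b)"
    using meas by (simp add: emeasure_distr)
  also have "\<dots> = ennreal (measure lebesgue (T -` box a b))"
    unfolding eq using measurable_orthogonal_image[OF T', of "box a b"]
    by (simp add: emeasure_eq_measure2)
  also have "\<dots> = ennreal (measure lebesgue (box a b))"
    unfolding eq using measure_orthogonal_image[OF T', of "box a b"] by simp
  also have "\<dots> = ennreal (\<Prod>i\<in>Basis. (b - a) \<bullet> i)"
    using le by (simp add: measure_lborel_box_eq)
  finally show "emeasure (distr lborel borel T) (box a b) = ennreal (\<Prod>i\<in>Basis. (b - a) \<bullet> i)" .
qed simp

lemma lborel_distr_rotation: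
  fixes u :: complex
  assumes "norm u = 1"
  shows "distr lborel borel ((*) u) = lborel"
proof -
  define V where "V = (\<lambda>x::real^2. Complex (x $ 1) (x $ 2))"
  define R :: "real^2 \<Rightarrow> real^2" where "R = (\<lambda>x. vector [Re (u * V x), Im (u * V x)])"
  have VR: "V (R x) = u * V x" for x
    by (simp add: V_def R_def complex_eq_iff)
  have norm_V: "norm (V x) = norm x" for x
    by (simp add: V_def cmod_def norm_vec_def L2_set_def UNIV_2)
  have "orthogonal_transformation R"
    unfolding orthogonal_transformation
  proof (intro conjI allI)
    show "linear R"
      by (rule linearI; simp add: R_def V_def vec_eq_iff forall_2 algebra_simps)
    show "norm (R x) = norm x" for x
      using assms by (metis VR norm_V norm_mult mult_1)
  qed
  note R = lborel_distr_orthogonal[OF this]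
  have [measurable]: "V \<in> borel_measurable borel"
    unfolding V_def Complex_eq by (intro borel_measurable_continuous_onI continuous_intros)
  have [measurable]: "R \<in> borel_measurable borel"
    using \<open>orthogonal_transformation R\<close> by (intro borel_measurable_continuous_onI linear_continuous_on)
       (simp add: orthogonal_transformation_def linear_linear)
  have V: "lborel = distr lborel borel V"
    unfolding V_def by (rule lborel_complex_eq_distr_vec)
  have "distr lborel borel ((*) u) = distr (distr lborel borel V) borel ((*) u)"
    by (subst V) (rule refl)
  also have "\<dots> = distr (distr lborel borel R) borel V"
    by (simp add: distr_distr o_def VR)
  also have "\<dots> = lborel"
    by (simp add: R flip: V)
  finally show ?thesis .
qed

text \<open>Integrating the rotation invariance over all angles and exchanging the integrals lets an integrand
  be replaced by its circular means. This is how radial weights are combined with Cauchy's formula below.\<close>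
lemma integral_eq_circle_average:
  fixes H G :: "complex \<Rightarrow> complex"
  assumes int: "integrable lborel H"
    and avg: "\<And>z. (LBINT t:{0..2*pi}. H (cis t * z)) = 2 * pi * G z"
  shows "(LBINT z. H z) = (LBINT z. G z)"
proof -
  have [measurable]: "H \<in> borel_measurable borel" using int by auto
  have [measurable]: "cis \<in> borel_measurable borel"
    by (intro borel_measurable_continuous_onI continuous_intros)
  have rot: "integrable lborel (\<lambda>z. H (cis t * z))" "(LBINT z. H (cis t * z)) = (LBINT z. H z)"
    "(LBINT z. norm (H (cis t * z))) = (LBINT z. norm (H z))" for t
  proof -
    have u: "distr lborel borel ((*) (cis t)) = lborel"
      by (rule lborel_distr_rotation) simp
    show "integrable lborel (\<lambda>z. H (cis t * z))"
      using int by (subst (asm) u[symmetric], subst (asm) integrable_distr_eq) auto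
    show "(LBINT z. H (cis t * z)) = (LBINT z. H z)"
      by (subst (2) u[symmetric], subst integral_distr) auto
    show "(LBINT z. norm (H (cis t * z))) = (LBINT z. norm (H z))"
      by (subst (2) u[symmetric], subst integral_distr) auto
  qed
  define P where "P = (\<lambda>t z. indicat_real {0..2*pi} t *\<^sub>R H (cis t * z))"
  have P: "integrable (lborel \<Otimes>\<^sub>M lborel) (\<lambda>(t, z). P t z)"
  proof (rule lborel_pair.Fubini_integrable)
    show "(\<lambda>(t, z). P t z) \<in> borel_measurable (lborel \<Otimes>\<^sub>M lborel)"
      unfolding P_def by measurable
    have "(\<lambda>t. LBINT z. norm (P t z)) = (\<lambda>t. indicat_real {0..2*pi} t * (LBINT z. norm (H z)))"
      by (simp add: P_def rot)
    then show "integrable lborel (\<lambda>t. LBINT z. norm (case (t, z) of (t, z) \<Rightarrow> P t z))"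
      by simp
  qed (simp add: P_def rot)
  have "2 * pi * (LBINT z. H z) = (LBINT t. (LBINT z. P t z))"
  proof -
    have "(LBINT t. (LBINT z. P t z)) = (LBINT t. indicat_real {0..2*pi} t *\<^sub>R (LBINT z. H z))"
      by (simp add: P_def rot)
    also have "\<dots> = (2 * pi) *\<^sub>R (LBINT z. H z)"
      by (subst integral_scaleR_left) auto
    finally show ?thesis by (simp add: scaleR_conv_of_real)
  qed
  also have "\<dots> = (LBINT z. (LBINT t. P t z))"
    by (rule lborel_pair.Fubini_integral[OF P, symmetric])
  also have "\<dots> = (LBINT z. 2 * pi * G z)"
    using avg by (simp add: P_def set_lebesgue_integral_def)
  also have "\<dots> = 2 * pi * (LBINT z. G z)"
    by simp
  finally show ?thesis by simp
qed

text \<open>Cauchy's formula for the derivatives at the centre of the unit circle, written as a Fourier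
  coefficient.\<close>
lemma integral_circle_coefficient:
  fixes g :: "complex \<Rightarrow> complex"
  assumes "g holomorphic_on UNIV"
  shows "(LBINT t:{0..2*pi}. g (cis t) * cis (- (real n * t))) = 2 * pi * ((deriv ^^ n) g 0 / fact n)"
proof -
  have "((\<lambda>u. g u / (u-0) ^ (Suc n)) has_contour_integral ((2 * pi * \<i>) / (fact n) * (deriv ^^ n) g 0)) (circlepath 0 1)"
    using assms by (intro Cauchy_has_contour_integral_higher_derivative_circlepath)
       (auto intro: holomorphic_on_subset holomorphic_on_imp_continuous_on)
  then have "((\<lambda>t. g (cis t) / cis t ^ (Suc n) * \<i> * cis t) has_integral
      ((2 * pi * \<i>) / (fact n) * (deriv ^^ n) g 0)) {0..2*pi}"
    unfolding circlepath_def by (subst (asm) has_contour_integral_part_circlepath_iff) auto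
  then have "((\<lambda>t. - \<i> * (g (cis t) / cis t ^ (Suc n) * \<i> * cis t)) has_integral
      (- \<i> * ((2 * pi * \<i>) / (fact n) * (deriv ^^ n) g 0))) {0..2*pi}"
    by (rule has_integral_mult_right)
  moreover have "- \<i> * (g (cis t) / cis t ^ (Suc n) * \<i> * cis t) = g (cis t) * cis (- (real n * t))" for t
  proof -
    have "cis (- (real n * t)) = inverse (cis t ^ n)"
      by (simp add: Complex.DeMoivre)
    moreover have "cis t ^ n \<noteq> 0" "cis t \<noteq> 0"
      by auto
    ultimately show ?thesis
      by (simp add: field_simps)
  qed
  moreover have "- \<i> * ((2 * pi * \<i>) / (fact n) * (deriv ^^ n) g 0) = 2 * pi * ((deriv ^^ n) g 0 / fact n)"
    by (simp add: field_simps)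
  ultimately have *: "((\<lambda>t. g (cis t) * cis (- (real n * t))) has_integral
      2 * pi * ((deriv ^^ n) g 0 / fact n)) {0..2*pi}"
    by simp
  have "continuous_on {0..2*pi} (\<lambda>t. g (cis t) * cis (- (real n * t)))"
    using assms
    by (intro continuous_intros continuous_on_compose2[OF holomorphic_on_imp_continuous_on[OF assms]]) auto
  then have "set_integrable lborel {0..2*pi} (\<lambda>t. g (cis t) * cis (- (real n * t)))"
    by (rule borel_integrable_atLeastAtMost')
  then show ?thesis
    using * by (metis set_borel_integral_eq_integral(2) integral_unique)
qed

section \<open>Decay and integrability\<close>

text \<open>Cover the plane by the annuli \<open>n \<le> \<bar>z\<bar> < n + 1\<close>: each contributes at most the area of
  the disc of radius \<open>n + 1\<close> times \<open>O ((n + 1) ^ (-4))\<close>, hence \<open>O ((n + 1) ^ (-2))\<close>.\<close>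
lemma integrable_decay_complex:
  fixes F :: "complex \<Rightarrow> 'a::{banach,second_countable_topology}"
  assumes [measurable]: "F \<in> borel_measurable lborel"
    and bound: "\<And>z. norm (F z) \<le> K / (1 + norm z) ^ 4"
  shows "integrable lborel F"
proof -
  define g :: "complex \<Rightarrow> nat \<Rightarrow> real" where
    "g = (\<lambda>z n. indicat_real (ball 0 (real n + 1)) z * (K * 2^4 / (real n + 1) ^ 4))"
  have K0: "K \<ge> 0"
    using order_trans[OF norm_ge_zero bound[of 0]] by simp
  show ?thesis
  proof (rule integrableI_bounded)
    have "(\<integral>\<^sup>+z. ennreal (norm (F z)) \<partial>lborel) \<le> (\<integral>\<^sup>+z. (\<Sum>n. ennreal (g z n)) \<partial>lborel)"
    proof (rule nn_integral_mono)
      fix z :: complex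
      define n where "n = nat \<lfloor>norm z\<rfloor>"
      have n: "real n \<le> norm z" "norm z < real n + 1"
        unfolding n_def by auto
      have "norm (F z) \<le> K / (1 + norm z) ^ 4" by (rule bound)
      also have "\<dots> \<le> K * 2^4 / (real n + 1) ^ 4"
      proof -
        have "(real n + 1)^4 \<le> (1 + norm z)^4" using n by (intro power_mono) auto
        then have "K / (1 + norm z) ^ 4 \<le> K / (real n + 1)^4"
          using K0 by (intro divide_left_mono) (auto intro!: mult_pos_pos zero_less_power add_pos_nonneg)
        also have "\<dots> \<le> K * 2^4 / (real n + 1)^4"
          using K0 by (intro divide_right_mono) auto
        finally show ?thesis .
      qed
      also have "\<dots> = g z n" using n by (simp add: g_def dist_norm)
      finally have "ennreal (norm (F z)) \<le> (\<Sum>k\<in>{n}. ennreal (g z k))"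
        by (simp add: ennreal_leI)
      also have "\<dots> \<le> (\<Sum>n. ennreal (g z n))"
        by (intro sum_le_suminf) auto
      finally show "ennreal (norm (F z)) \<le> (\<Sum>n. ennreal (g z n))" .
    qed
    also have "\<dots> = (\<Sum>n. \<integral>\<^sup>+z. ennreal (g z n) \<partial>lborel)"
      proof (rule nn_integral_suminf)
      fix n
      have [measurable]: "(indicat_real (ball (0::complex) (real n + 1))) \<in> borel_measurable borel"
        by (rule borel_measurable_indicator) simp
      show "(\<lambda>z. ennreal (g z n)) \<in> borel_measurable lborel"
        unfolding g_def by measurable
    qed
    also have "\<dots> = (\<Sum>n. ennreal (K * 2^4 * pi / (real n + 1)^2))"
    proof (intro arg_cong[where f=suminf] ext)
      fix n
      have "(\<integral>\<^sup>+z. ennreal (g z n) \<partial>lborel)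
         = (\<integral>\<^sup>+z. ennreal (K * 2^4 / (real n + 1) ^ 4) * indicator (ball (0::complex) (real n + 1)) z \<partial>lborel)"
        by (intro nn_integral_cong) (auto simp: g_def indicator_def)
      also have "\<dots> = ennreal (K * 2^4 / (real n + 1) ^ 4) * ennreal (pi * (real n + 1)^2)"
        by (simp add: nn_integral_cmult_indicator emeasure_ball unit_ball_vol_2)
      also have "\<dots> = ennreal (K * 2^4 * pi / (real n + 1)^2)"
      proof -
        have "x / y ^ 4 * (pi * y\<^sup>2) = x * pi / y\<^sup>2" if "y > 0" for x y :: real
          using that by (simp add: field_simps eval_nat_numeral)
        from this[of "real n + 1" "K * 2 ^ 4"] show ?thesis
          using K0 by (subst ennreal_mult[symmetric]) auto
      qed
      finally show "(\<integral>\<^sup>+z. ennreal (g z n) \<partial>lborel) = ennreal (K * 2^4 * pi / (real n + 1)^2)" .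
    qed
    also have "\<dots> < \<infinity>"
    proof -
      have "summable (\<lambda>n. inverse ((real (Suc n))^2))"
        by (subst summable_Suc_iff) (rule inverse_power_summable, simp)
      then have "summable (\<lambda>n. K * 2^4 * pi * inverse ((real (Suc n))^2))"
        by (rule summable_mult)
      then have s: "summable (\<lambda>n. K * 2^4 * pi / (real n + 1)^2)"
        by (simp add: field_simps)
      show ?thesis
        using K0 by (subst suminf_ennreal_eq[OF _ summable_sums[OF s]]) auto
    qed
    finally show "(\<integral>\<^sup>+z. ennreal (norm (F z)) \<partial>lborel) < \<infinity>" .
  qed simp
qed

lemma exp_powr_decay:
  fixes e m :: real assumes "e > 0" "m > 0"
  shows "\<exists>K. \<forall>t\<ge>0. t ^ k * exp (- e * t powr m) \<le> K / (1 + t) ^ 4"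
proof -
  have "((\<lambda>t. t ^ k * exp (- e * t powr m) * (1+t)^4) \<longlongrightarrow> 0) at_top"
    using assms by real_asymp
  from order_tendstoD(2)[OF this, of 1] obtain T where T: "\<And>t. t \<ge> T \<Longrightarrow> t ^ k * exp (- e * t powr m) * (1+t)^4 < 1"
    by (auto simp: eventually_at_top_linorder)
  define T' where "T' = max T 0"
  have "t ^ k * exp (- e * t powr m) * (1+t)^4 \<le> max 1 (T' ^ k * (1 + T')^4)" if "t \<ge> 0" for t
  proof (cases "t \<ge> T'")
    case True then show ?thesis using T[of t] by (auto simp: T'_def)
  next
    case False
    have "t ^ k * exp (- e * t powr m) * (1+t)^4 \<le> T' ^ k * 1 * (1 + T')^4"
      using False that assms by (intro mult_mono power_mono) auto
    then show ?thesis by simp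
  qed
  then show ?thesis
    by (intro exI[of _ "max 1 (T' ^ k * (1 + T')^4)"]) (auto simp: pos_le_divide_eq)
qed

text \<open>Since \<open>\<rho> < 1\<close>, for large \<open>t\<close> one has \<open>b + \<rho> * t \<le> \<sigma> * t\<close> with a ratio
  \<open>\<sigma> < 1\<close>, so that the exponent is at most
  \<open>\<delta> * t - \<alpha> * (1 - \<sigma> powr m) * t powr m\<close>. Half of the negative term absorbs
  \<open>\<delta> * t\<close>, either because \<open>m > 1\<close> or because \<open>\<delta> = 0\<close>.\<close>
lemma dominating_weight_decay:
  fixes \<alpha> m \<delta> \<rho> b :: real
  assumes \<alpha>: "\<alpha> > 0" and m: "m > 0" and \<delta>: "\<delta> \<ge> 0" "\<delta> = 0 \<or> m > 1" and \<rho>: "0 \<le> \<rho>" "\<rho> < 1" and b: "b > 0"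
  shows "\<exists>K. \<forall>t\<ge>0. exp (\<delta> * t + \<alpha> * (b + \<rho> * t) powr m - \<alpha> * t powr m) \<le> K / (1 + t) ^ 4"
proof -
  define \<sigma> where "\<sigma> = (1 + \<rho>) / 2"
  have \<sigma>: "0 < \<sigma>" "\<sigma> < 1" "\<rho> < \<sigma>" using \<rho> by (auto simp: \<sigma>_def)
  define e where "e = \<alpha> * (1 - \<sigma> powr m) / 2"
  have "\<sigma> powr m < 1" using powr_less_mono2[of m \<sigma> 1] m \<sigma> by simp
  then have e: "e > 0" using \<alpha> by (simp add: e_def)
  have ev1: "\<forall>\<^sub>F t in at_top. \<delta> * t \<le> e * t powr m"
  proof (cases "\<delta> = 0")
    case True then show ?thesis using e by simp
  next
    case False
    then have "\<delta> > 0" "m > 1" using \<delta> by auto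
    then show ?thesis using e by real_asymp
  qed
  have ev2: "\<forall>\<^sub>F t in at_top. b \<le> (\<sigma> - \<rho>) * t"
    using eventually_ge_at_top[of "b / (\<sigma> - \<rho>)"]
    by eventually_elim (use \<sigma> in \<open>simp add: pos_divide_le_eq mult.commute\<close>)
  from eventually_conj[OF ev1 ev2] obtain T0 where T0:
    "\<And>t. t \<ge> T0 \<Longrightarrow> \<delta> * t \<le> e * t powr m" "\<And>t. t \<ge> T0 \<Longrightarrow> b \<le> (\<sigma> - \<rho>) * t"
    by (auto simp: eventually_at_top_linorder)
  define T where "T = max T0 0"
  define C where "C = exp (\<delta> * T + \<alpha> * (b + \<rho> * T) powr m + e * T powr m)"
  have "T \<ge> 0" by (simp add: T_def)
  have "C \<ge> 1" unfolding C_def using \<alpha> e \<delta> \<open>T \<ge> 0\<close> by simp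
  have bound: "exp (\<delta> * t + \<alpha> * (b + \<rho> * t) powr m - \<alpha> * t powr m) \<le> C * exp (- e * t powr m)" if t: "t \<ge> 0" for t
  proof (cases "t \<ge> T")
    case True
    then have 1: "\<delta> * t \<le> e * t powr m" and 2: "b + \<rho> * t \<le> \<sigma> * t"
      using T0[of t] by (auto simp: T_def algebra_simps)
    have "(b + \<rho> * t) powr m \<le> (\<sigma> * t) powr m"
      using 2 b \<rho> t m by (intro powr_mono2) auto
    also have "\<dots> = \<sigma> powr m * t powr m" using \<sigma> t by (simp add: powr_mult)
    finally have "\<alpha> * (b + \<rho> * t) powr m \<le> \<alpha> * (\<sigma> powr m * t powr m)"
      using \<alpha> by simp
    moreover have "\<alpha> * (\<sigma> powr m * t powr m) = \<alpha> * t powr m - 2 * e * t powr m"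
      by (simp add: e_def field_simps)
    ultimately have "\<delta> * t + \<alpha> * (b + \<rho> * t) powr m - \<alpha> * t powr m \<le> - e * t powr m"
      using 1 by simp
    then have "exp (\<delta> * t + \<alpha> * (b + \<rho> * t) powr m - \<alpha> * t powr m) \<le> 1 * exp (- e * t powr m)"
      by simp
    also have "\<dots> \<le> C * exp (- e * t powr m)"
      using \<open>C \<ge> 1\<close> by (intro mult_right_mono) auto
    finally show ?thesis .
  next
    case False
    have "\<delta> * t \<le> \<delta> * T" using False \<delta> by (intro mult_left_mono) auto
    moreover have "(b + \<rho> * t) powr m \<le> (b + \<rho> * T) powr m"
      using False b \<rho> t m by (intro powr_mono2 add_left_mono mult_left_mono) auto
    then have "\<alpha> * (b + \<rho> * t) powr m \<le> \<alpha> * (b + \<rho> * T) powr m" using \<alpha> by simp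
    moreover have "t powr m \<le> T powr m" using False t m by (intro powr_mono2) auto
    then have "e * t powr m \<le> e * T powr m" using e by simp
    moreover have "\<alpha> * t powr m \<ge> 0" using \<alpha> by simp
    ultimately have "\<delta> * t + \<alpha> * (b + \<rho> * t) powr m - \<alpha> * t powr m
       \<le> \<delta> * T + \<alpha> * (b + \<rho> * T) powr m + e * T powr m + - e * t powr m"
      by simp
    then show ?thesis unfolding C_def exp_add[symmetric] by simp
  qed
  obtain K where K: "\<And>t. t \<ge> 0 \<Longrightarrow> exp (- e * t powr m) \<le> K / (1 + t) ^ 4"
    using exp_powr_decay[OF e m, of 0] by auto
  show ?thesis
  proof (intro exI allI impI)
    fix t :: real assume t: "t \<ge> 0"
    have "C * exp (- e * t powr m) \<le> C * (K / (1 + t) ^ 4)"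
      using K[OF t] \<open>C \<ge> 1\<close> by (intro mult_left_mono) auto
    then show "exp (\<delta> * t + \<alpha> * (b + \<rho> * t) powr m - \<alpha> * t powr m) \<le> C * K / (1 + t) ^ 4"
      using bound[OF t] by simp
  qed
qed

section \<open>Taylor coefficients at the origin\<close>

definition taylor_coeff :: "(complex \<Rightarrow> complex) \<Rightarrow> nat \<Rightarrow> complex" where
  "taylor_coeff f n = (deriv ^^ n) f 0 / fact n"

lemma taylor_coeff_power: "taylor_coeff (\<lambda>z. z ^ j) n = (if j = n then 1 else 0)"
proof -
  have eq: "(deriv ^^ n) (\<lambda>z. z ^ j) (0::complex) = pochhammer (of_nat (Suc j - n)) n * 0 ^ (j - n)"
    using higher_deriv_power[of n 0 j 0] by simp
  consider "j = n" | "j > n" | "j < n" by linarith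
  then show ?thesis
  proof cases
    case 1
    then have "Suc j - n = 1" by simp
    with 1 have "(deriv ^^ n) (\<lambda>z. z ^ j) (0::complex) = pochhammer 1 n"
      using eq by (simp only: of_nat_1 diff_self_eq_0 power_0 mult_1_right)
    then show ?thesis using 1 by (simp add: taylor_coeff_def pochhammer_fact[symmetric])
  next
    case 2
    then show ?thesis by (simp add: taylor_coeff_def eq)
  next
    case 3
    then show ?thesis by (simp add: taylor_coeff_def eq pochhammer_0_left)
  qed
qed

lemma taylor_coeff_sums:
  assumes "f holomorphic_on UNIV"
  shows "(\<lambda>n. taylor_coeff f n * z ^ n) sums f z"
  using holomorphic_power_series[of f 0 "norm z + 1" z] assms
  by (simp add: taylor_coeff_def holomorphic_on_subset[OF assms])

section \<open>Elementary structure of the Fock space\<close>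

lemma norm_add_squared_le:
  fixes x y :: "'a::real_normed_vector"
  shows "(norm (x + y))\<^sup>2 \<le> 2 * (norm x)\<^sup>2 + 2 * (norm y)\<^sup>2"
proof -
  have "(norm (x + y))\<^sup>2 \<le> (norm x + norm y)\<^sup>2"
    by (intro power_mono norm_triangle_ineq) auto
  also have "\<dots> \<le> 2 * (norm x)\<^sup>2 + 2 * (norm y)\<^sup>2"
    using zero_le_power2[of "norm x - norm y"] by (simp add: power2_sum power2_diff)
  finally show ?thesis .
qed

lemma fock_constant_pos:
  fixes \<alpha> m :: real
  assumes "\<alpha> > 0" "m > 0"
  shows "m * \<alpha> powr (2 / m) / (2 * pi * Gamma (2 / m)) > 0"
  using assms by (intro divide_pos_pos mult_pos_pos) (auto intro: Gamma_real_pos)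

definition fock_weight :: "real \<Rightarrow> real \<Rightarrow> complex \<Rightarrow> real" where
  "fock_weight \<alpha> m z = m * \<alpha> powr (2 / m) / (2 * pi * Gamma (2 / m)) * exp (- \<alpha> * norm z powr m)"

locale fock_parameters =
  fixes \<alpha> m :: real
  assumes \<alpha>: "\<alpha> > 0" and m: "m > 0"
begin

lemma fock_measure_density: "fock_measure \<alpha> m = density lborel (\<lambda>z. ennreal (fock_weight \<alpha> m z))"
  unfolding fock_measure_def fock_weight_def ..

lemma fock_weight_measurable [measurable]: "fock_weight \<alpha> m \<in> borel_measurable borel"
  unfolding fock_weight_def by measurable

lemma sets_fock_measure [measurable_cong]: "sets (fock_measure \<alpha> m) = sets borel"
  by (simp add: fock_measure_density)

lemma fock_weight_pos: "fock_weight \<alpha> m z > 0"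
  unfolding fock_weight_def using fock_constant_pos[OF \<alpha> m] by (intro mult_pos_pos) auto

lemma fock_weight_nonneg: "fock_weight \<alpha> m z \<ge> 0"
  using fock_weight_pos[of z] by simp

lemma integrable_fock_measure_iff:
  fixes F :: "complex \<Rightarrow> 'a::{banach,second_countable_topology}"
  assumes "F \<in> borel_measurable borel"
  shows "integrable (fock_measure \<alpha> m) F \<longleftrightarrow> integrable lborel (\<lambda>z. fock_weight \<alpha> m z *\<^sub>R F z)"
  unfolding fock_measure_density
  by (rule integrable_density) (use assms fock_weight_nonneg in auto)

lemma integral_fock_measure:
  fixes F :: "complex \<Rightarrow> 'a::{banach,second_countable_topology}"
  assumes "F \<in> borel_measurable borel"
  shows "(LINT z|fock_measure \<alpha> m. F z) = (LBINT z. fock_weight \<alpha> m z *\<^sub>R F z)"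
  unfolding fock_measure_density
  by (rule integral_density) (use assms fock_weight_nonneg in auto)

lemma entire_measurable:
  "f holomorphic_on UNIV \<Longrightarrow> (f :: complex \<Rightarrow> complex) \<in> borel_measurable borel"
  by (intro borel_measurable_continuous_onI holomorphic_on_imp_continuous_on)

lemma fock_space_measurable: "f \<in> fock_space \<alpha> m \<Longrightarrow> f \<in> borel_measurable borel"
  by (simp add: fock_space_def entire_measurable)

lemma fock_norm_nonneg: "fock_norm \<alpha> m f \<ge> 0"
  unfolding fock_norm_eq by simp

lemma fock_norm_squared: "(fock_norm \<alpha> m f)\<^sup>2 = (LINT z|fock_measure \<alpha> m. (norm (f z))\<^sup>2)"
  unfolding fock_norm_eq by simp

lemma fock_spaceI_dominated:
  assumes f: "f holomorphic_on UNIV" and D: "integrable lborel D"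
    and le: "\<And>z. fock_weight \<alpha> m z * (norm (f z))\<^sup>2 \<le> D z"
  shows "f \<in> fock_space \<alpha> m"
proof -
  note [measurable] = entire_measurable[OF f]
  have "integrable lborel (\<lambda>z. fock_weight \<alpha> m z *\<^sub>R (norm (f z))\<^sup>2)"
    by (rule Bochner_Integration.integrable_bound[OF D])
       (use le fock_weight_nonneg in \<open>auto intro!: AE_I2 order_trans[OF le abs_ge_self]\<close>)
  then show ?thesis
    using f by (simp add: fock_space_def integrable_fock_measure_iff)
qed

lemma fock_space_add:
  assumes f: "f \<in> fock_space \<alpha> m" and g: "g \<in> fock_space \<alpha> m"
  shows "(\<lambda>z. f z + g z) \<in> fock_space \<alpha> m"
proof -
  note [measurable] = fock_space_measurable[OF f] fock_space_measurable[OF g]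
  have "integrable (fock_measure \<alpha> m) (\<lambda>z. 2 * (norm (f z))\<^sup>2 + 2 * (norm (g z))\<^sup>2)"
    using f g by (simp add: fock_space_def)
  then have "integrable (fock_measure \<alpha> m) (\<lambda>z. (norm (f z + g z))\<^sup>2)"
    by (rule Bochner_Integration.integrable_bound) (auto intro!: AE_I2 norm_add_squared_le)
  then show ?thesis
    using f g by (auto simp: fock_space_def intro: holomorphic_on_add)
qed

lemma fock_space_scale:
  assumes f: "f \<in> fock_space \<alpha> m"
  shows "(\<lambda>z. k * f z) \<in> fock_space \<alpha> m"
  using f by (auto simp: fock_space_def norm_mult power_mult_distrib intro: holomorphic_intros)

lemma fock_space_diff:
  assumes f: "f \<in> fock_space \<alpha> m" and g: "g \<in> fock_space \<alpha> m"
  shows "(\<lambda>z. f z - g z) \<in> fock_space \<alpha> m"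
  using fock_space_add[OF f fock_space_scale[OF g, of "-1"]] by simp

lemma fock_space_power: "(\<lambda>z. z ^ n) \<in> fock_space \<alpha> m"
proof -
  obtain K where K: "\<And>t. t \<ge> 0 \<Longrightarrow> t ^ (2*n) * exp (- \<alpha> * t powr m) \<le> K / (1 + t) ^ 4"
    using exp_powr_decay[OF \<alpha> m, of "2*n"] by auto
  define \<kappa> where "\<kappa> = m * \<alpha> powr (2 / m) / (2 * pi * Gamma (2 / m))"
  have \<kappa>: "\<kappa> > 0" using fock_constant_pos[OF \<alpha> m] by (simp add: \<kappa>_def)
  have K0: "K \<ge> 0"
    using K[of 0] by (simp split: if_splits) (metis order_trans zero_le_power2 power_0_left zero_le_one)
  have int: "integrable lborel (\<lambda>z::complex. \<kappa> * K / (1 + norm z) ^ 4)"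
  proof (rule integrable_decay_complex[where K="\<kappa> * K"])
    have "\<kappa> * K / (1 + norm z) ^ 4 \<ge> 0" for z :: complex
      using K0 \<kappa> by (intro mult_nonneg_nonneg divide_nonneg_nonneg) auto
    then show "norm (\<kappa> * K / (1 + norm z) ^ 4) \<le> \<kappa> * K / (1 + norm z) ^ 4" for z :: complex
      by (metis real_norm_def abs_of_nonneg order_refl)
  qed measurable
  show ?thesis
  proof (rule fock_spaceI_dominated[OF _ int])
    fix z :: complex
    have "fock_weight \<alpha> m z * (norm (z ^ n))\<^sup>2 = \<kappa> * (norm z ^ (2*n) * exp (- \<alpha> * norm z powr m))"
      by (simp add: fock_weight_def norm_power flip: power_mult \<kappa>_def) (simp add: mult_ac)
    also have "\<dots> \<le> \<kappa> * (K / (1 + norm z) ^ 4)"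
      using \<kappa> K[of "norm z"] by (intro mult_left_mono) auto
    finally show "fock_weight \<alpha> m z * (norm (z ^ n))\<^sup>2 \<le> \<kappa> * K / (1 + norm z) ^ 4" by simp
  qed (intro holomorphic_intros)
qed

lemma fock_space_poly: "(\<lambda>z. \<Sum>n\<in>A. b n * z ^ n) \<in> fock_space \<alpha> m"
proof (induction A rule: infinite_finite_induct)
  case (insert x F)
  then show ?case using fock_space_add[OF fock_space_scale[OF fock_space_power] insert.IH] by simp
qed (use fock_space_scale[OF fock_space_power, of 0 0] in auto)

lemma fock_inner_integrable:
  assumes f: "f \<in> fock_space \<alpha> m" and g: "g \<in> fock_space \<alpha> m"
  shows "integrable (fock_measure \<alpha> m) (\<lambda>z. f z * cnj (g z))"
proof -
  note [measurable] = fock_space_measurable[OF f] fock_space_measurable[OF g]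
  have [measurable]: "cnj \<in> borel_measurable borel"
    by (intro borel_measurable_continuous_onI continuous_intros)
  have "integrable (fock_measure \<alpha> m) (\<lambda>z. (norm (f z))\<^sup>2 + (norm (g z))\<^sup>2)"
    using f g by (simp add: fock_space_def)
  then show ?thesis
  proof (rule Bochner_Integration.integrable_bound)
    have "norm (x * cnj y) \<le> norm ((norm x)\<^sup>2 + (norm y)\<^sup>2)" for x y :: complex
    proof -
      have "0 \<le> (norm x - norm y)\<^sup>2" "0 \<le> norm x * norm y" by auto
      then have "norm x * norm y \<le> (norm x)\<^sup>2 + (norm y)\<^sup>2" by (simp only: power2_diff)
      then show ?thesis by (simp add: norm_mult)
    qed
    then show "AE z in fock_measure \<alpha> m. norm (f z * cnj (g z)) \<le> norm ((norm (f z))\<^sup>2 + (norm (g z))\<^sup>2)"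
      by blast
  qed measurable
qed

text \<open>The square of \<open>f\<close> has the mean value property over the unit disc around \<open>w\<close>, on which the
  weight is at least a constant times \<open>exp (- \<alpha> * (\<bar>w\<bar> + 1) powr m)\<close>. The shift by \<open>1\<close> only adds a
  constant to the modulus inside the power, as the constant term of an affine symbol does.\<close>
lemma fock_pointwise_bound:
  "\<exists>K>0. \<forall>f\<in>fock_space \<alpha> m. \<forall>w.
     (norm (f w))\<^sup>2 \<le> K * exp (\<alpha> * (norm w + 1) powr m) * (fock_norm \<alpha> m f)\<^sup>2"
proof -
  define \<kappa> where "\<kappa> = m * \<alpha> powr (2 / m) / (2 * pi * Gamma (2 / m))"
  have \<kappa>: "\<kappa> > 0" using fock_constant_pos[OF \<alpha> m] by (simp add: \<kappa>_def)
  have "(norm (f w))\<^sup>2 \<le> inverse (pi * \<kappa>) * exp (\<alpha> * (norm w + 1) powr m) * (fock_norm \<alpha> m f)\<^sup>2"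
    if f: "f \<in> fock_space \<alpha> m" for f w
  proof -
    note [measurable] = fock_space_measurable[OF f]
    have hol: "f holomorphic_on UNIV" using f by (simp add: fock_space_def)
    have cont: "continuous_on A f" for A
      using hol by (meson continuous_on_subset holomorphic_on_imp_continuous_on subset_UNIV)
    define I where "I = indicat_real (cball (0::complex) 1)"
    \<comment> \<open>The translate of \<open>f\<^sup>2\<close> to the origin, cut off outside the unit disc.\<close>
    define H where "H = (\<lambda>z. I z *\<^sub>R (f (w + z))\<^sup>2)"
    have int: "integrable lborel H"
      unfolding H_def I_def
      by (rule borel_integrable_compact)
         (auto intro!: continuous_intros continuous_on_compose2[OF cont[of UNIV]])
    have "(LBINT z. H z) = (LBINT z. I z *\<^sub>R (f w)\<^sup>2)"
    proof (rule integral_eq_circle_average[OF int])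
      fix z
      have "(\<lambda>\<zeta>. (f (w + z * \<zeta>))\<^sup>2) holomorphic_on UNIV"
        by (intro holomorphic_intros holomorphic_on_compose_gen[OF _ hol, unfolded o_def]) auto
      from integral_circle_coefficient[OF this, of 0]
      have "(LBINT t:{0..2*pi}. (f (w + cis t * z))\<^sup>2) = 2 * pi * (f w)\<^sup>2"
        by (simp add: mult.commute)
      moreover have "H (cis t * z) = I z *\<^sub>R (f (w + cis t * z))\<^sup>2" for t
        by (simp add: H_def I_def indicator_def norm_mult)
      ultimately show "(LBINT t:{0..2*pi}. H (cis t * z)) = 2 * pi * (I z *\<^sub>R (f w)\<^sup>2)"
        by simp
    qed
    also have "\<dots> = pi * (f w)\<^sup>2"
      unfolding I_def by (subst integral_scaleR_left)
         (auto simp: content_cball unit_ball_vol_2 scaleR_conv_of_real emeasure_cball)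
    finally have "pi * (norm (f w))\<^sup>2 = norm (LBINT z. H z)"
      by (simp add: norm_mult norm_power)
    also have "\<dots> \<le> (LBINT z. norm (H z))"
      by (rule integral_norm_bound)
    also have "\<dots> = (LBINT z. norm (H (z - w)))"
    proof -
      have "(LBINT z. norm (H z)) = integral\<^sup>L (distr lborel borel ((+) (-w))) (\<lambda>z. norm (H z))"
        by (subst lborel_distr_plus) (rule refl)
      also have "\<dots> = (LBINT z. norm (H (z - w)))"
        using int by (subst integral_distr) auto
      finally show ?thesis .
    qed
    also have "\<dots> \<le> (LBINT z. (inverse \<kappa> * exp (\<alpha> * (norm w + 1) powr m)) * (fock_weight \<alpha> m z *\<^sub>R (norm (f z))\<^sup>2))"
    proof (rule integral_mono_AE')
      show "integrable lborel (\<lambda>z. (inverse \<kappa> * exp (\<alpha> * (norm w + 1) powr m)) * (fock_weight \<alpha> m z *\<^sub>R (norm (f z))\<^sup>2))"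
        using f by (subst (asm) fock_space_def) (simp add: integrable_fock_measure_iff)
      have "norm (H (z - w)) \<le> (inverse \<kappa> * exp (\<alpha> * (norm w + 1) powr m)) * (fock_weight \<alpha> m z *\<^sub>R (norm (f z))\<^sup>2)" for z
      proof (cases "norm (z - w) \<le> 1")
        case True
        then have "norm z \<le> norm w + 1" using norm_triangle_ineq2[of z w] by linarith
        then have "norm z powr m \<le> (norm w + 1) powr m" using m by (intro powr_mono2) auto
        then have "1 \<le> exp (\<alpha> * (norm w + 1) powr m) * exp (- \<alpha> * norm z powr m)"
          using \<alpha> by (simp flip: exp_add)
        then have "1 * (norm (f z))\<^sup>2 \<le> (exp (\<alpha> * (norm w + 1) powr m) * exp (- \<alpha> * norm z powr m)) * (norm (f z))\<^sup>2"
          by (intro mult_right_mono) auto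
        then show ?thesis
          using True \<kappa> by (simp add: H_def I_def fock_weight_def norm_power flip: \<kappa>_def) (simp add: field_simps)
      next
        case False
        then show ?thesis using \<kappa> fock_weight_nonneg[of z] by (simp add: H_def I_def)
      qed
      then show "AE z in lborel. norm (H (z - w)) \<le> (inverse \<kappa> * exp (\<alpha> * (norm w + 1) powr m)) * (fock_weight \<alpha> m z *\<^sub>R (norm (f z))\<^sup>2)"
        by simp
      show "AE z in lborel. 0 \<le> (inverse \<kappa> * exp (\<alpha> * (norm w + 1) powr m)) * (fock_weight \<alpha> m z *\<^sub>R (norm (f z))\<^sup>2)"
        using \<kappa> fock_weight_nonneg by simp
    qed
    also have "\<dots> = (inverse \<kappa> * exp (\<alpha> * (norm w + 1) powr m)) * (fock_norm \<alpha> m f)\<^sup>2"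
      by (simp add: fock_norm_squared integral_fock_measure)
    finally show ?thesis using \<kappa> by (simp add: field_simps)
  qed
  then show ?thesis using \<kappa> by (intro exI[of _ "inverse (pi * \<kappa>)"]) auto
qed

section \<open>Orthogonality of monomials and Bessel's inequality\<close>

text \<open>The squared norm of the monomial \<open>z ^ n\<close>.\<close>
definition fock_moment :: "nat \<Rightarrow> real" where
  "fock_moment n = (LINT z|fock_measure \<alpha> m. norm z ^ (2 * n))"

text \<open>The integrand vanishes at most at the origin, which is a null set.\<close>
lemma fock_moment_pos: "fock_moment n > 0"
proof -
  have int: "integrable lborel (\<lambda>z. fock_weight \<alpha> m z * norm z ^ (2 * n))"
    using fock_space_power[of n]
    by (simp add: fock_space_def integrable_fock_measure_iff norm_power mult.commute flip: power_mult)
  have eq: "fock_moment n = (LBINT z. fock_weight \<alpha> m z * norm z ^ (2 * n))"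
    unfolding fock_moment_def by (subst integral_fock_measure) auto
  have "fock_moment n \<noteq> 0"
  proof
    assume "fock_moment n = 0"
    then have "AE z in lborel. fock_weight \<alpha> m z * norm z ^ (2 * n) = 0"
      using integral_nonneg_eq_0_iff_AE[OF int] fock_weight_nonneg by (simp add: eq)
    moreover have "AE z in lborel. z \<noteq> (0::complex)"
      by (rule AE_lborel_singleton)
    ultimately have "AE z in lborel. (z::complex) \<in> {}"
    proof eventually_elim
      case (elim z) then show ?case using fock_weight_pos[of z] by auto
    qed
    then show False
      using AE_iff_null_sets[of "UNIV::complex set" lborel] by (auto simp: null_sets_def dest!: AE_E2)
  qed
  moreover have "fock_moment n \<ge> 0" unfolding fock_moment_def by simp
  ultimately show ?thesis by linarith
qed

text \<open>The weight is constant on circles, and the mean over a circle of \<open>f\<close> times the conjugate of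
  \<open>z ^ n\<close> is the \<open>n\<close>-th Taylor coefficient times \<open>\<bar>z\<bar> ^ (2 * n)\<close>. Thus the
  monomials form an orthogonal system and Taylor coefficients are Fourier coefficients.\<close>
lemma fock_inner_power:
  assumes f: "f \<in> fock_space \<alpha> m"
  shows "fock_inner \<alpha> m f (\<lambda>z. z ^ n) = taylor_coeff f n * fock_moment n"
proof -
  have hol: "f holomorphic_on UNIV" using f by (simp add: fock_space_def)
  have [measurable]: "cnj \<in> borel_measurable borel"
    by (intro borel_measurable_continuous_onI continuous_intros)
  note [measurable] = fock_space_measurable[OF f]
  define H where "H = (\<lambda>z. fock_weight \<alpha> m z *\<^sub>R (f z * cnj (z ^ n)))"
  have int: "integrable lborel H"
    using fock_inner_integrable[OF f fock_space_power[of n]]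
    unfolding H_def by (subst (asm) integrable_fock_measure_iff) auto
  have "fock_inner \<alpha> m f (\<lambda>z. z ^ n) = (LBINT z. H z)"
    unfolding fock_inner_def H_def by (rule integral_fock_measure) measurable
  also have "\<dots> = (LBINT z. fock_weight \<alpha> m z *\<^sub>R (taylor_coeff f n * of_real (norm z ^ (2 * n))))"
  proof (rule integral_eq_circle_average[OF int])
    fix z
    have "(\<lambda>\<zeta>. f (z * \<zeta>)) holomorphic_on UNIV"
      by (intro holomorphic_intros holomorphic_on_compose_gen[OF _ hol, unfolded o_def]) auto
    note this[THEN integral_circle_coefficient, of n]
    also have "(deriv ^^ n) (\<lambda>\<zeta>. f (z * \<zeta>)) 0 = z ^ n * (deriv ^^ n) f 0"
      using higher_deriv_compose_linear[OF hol open_UNIV open_UNIV, of 0 z n] by simp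
    finally have *: "(LBINT t:{0..2*pi}. f (z * cis t) * cis (- (real n * t))) = 2 * pi * (z ^ n * taylor_coeff f n)"
      by (simp add: taylor_coeff_def)
    have "H (cis t * z) = (fock_weight \<alpha> m z *\<^sub>R cnj (z ^ n)) * (f (z * cis t) * cis (- (real n * t)))" for t
      by (simp add: H_def fock_weight_def norm_mult power_mult_distrib Complex.DeMoivre cis_cnj mult_ac flip: complex_cnj_power)
    then have "(LBINT t:{0..2*pi}. H (cis t * z)) = (fock_weight \<alpha> m z *\<^sub>R cnj (z ^ n)) * (2 * pi * (z ^ n * taylor_coeff f n))"
      by (simp only: set_integral_mult_right *)
    also have "\<dots> = 2 * pi * (fock_weight \<alpha> m z *\<^sub>R (taylor_coeff f n * (z ^ n * cnj (z ^ n))))"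
      by (simp add: scaleR_conv_of_real mult_ac)
    also have "z ^ n * cnj (z ^ n) = of_real (norm z ^ (2 * n))"
      by (subst complex_norm_square[symmetric]) (simp add: norm_power mult.commute flip: power_mult)
    finally show "(LBINT t:{0..2*pi}. H (cis t * z)) = 2 * pi * (fock_weight \<alpha> m z *\<^sub>R (taylor_coeff f n * of_real (norm z ^ (2 * n))))" .
  qed
  also have "\<dots> = (LINT z|fock_measure \<alpha> m. taylor_coeff f n * of_real (norm z ^ (2 * n)))"
    by (rule integral_fock_measure[symmetric]) measurable
  also have "\<dots> = taylor_coeff f n * fock_moment n"
    unfolding fock_moment_def by (simp del: of_real_power)
  finally show ?thesis .
qed

lemma fock_inner_power_power:
  "fock_inner \<alpha> m (\<lambda>z. z ^ j) (\<lambda>z. z ^ n) = (if j = n then of_real (fock_moment n) else 0)"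
  by (simp add: fock_inner_power[OF fock_space_power] taylor_coeff_power)

lemma fock_inner_poly:
  assumes f: "f \<in> fock_space \<alpha> m"
  shows "fock_inner \<alpha> m f (\<lambda>z. \<Sum>n\<in>A. b n * z ^ n) = (\<Sum>n\<in>A. cnj (b n) * taylor_coeff f n * fock_moment n)"
proof -
  have int: "integrable (fock_measure \<alpha> m) (\<lambda>z. cnj (b n) * (f z * cnj (z ^ n)))" for n
    by (intro integrable_mult_right fock_inner_integrable f fock_space_power)
  have "fock_inner \<alpha> m f (\<lambda>z. \<Sum>n\<in>A. b n * z ^ n) = (LINT z|fock_measure \<alpha> m. (\<Sum>n\<in>A. cnj (b n) * (f z * cnj (z ^ n))))"
    unfolding fock_inner_def by (simp add: sum_distrib_left mult_ac)
  also have "\<dots> = (\<Sum>n\<in>A. cnj (b n) * fock_inner \<alpha> m f (\<lambda>z. z ^ n))"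
    by (subst Bochner_Integration.integral_sum) (use int in \<open>auto simp: fock_inner_def simp del: complex_cnj_power\<close>)
  finally show ?thesis by (simp add: fock_inner_power[OF f] mult_ac)
qed

lemma taylor_coeff_poly:
  assumes "finite A" "n \<in> A"
  shows "taylor_coeff (\<lambda>z. \<Sum>k\<in>A. b k * z ^ k) n = b n"
proof -
  have int: "integrable (fock_measure \<alpha> m) (\<lambda>z. b k * (z ^ k * cnj (z ^ n)))" for k
    by (intro integrable_mult_right fock_inner_integrable fock_space_power)
  have "taylor_coeff (\<lambda>z. \<Sum>k\<in>A. b k * z ^ k) n * fock_moment n = fock_inner \<alpha> m (\<lambda>z. \<Sum>k\<in>A. b k * z ^ k) (\<lambda>z. z ^ n)"
    by (rule fock_inner_power[OF fock_space_poly, symmetric])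
  also have "\<dots> = (LINT z|fock_measure \<alpha> m. (\<Sum>k\<in>A. b k * (z ^ k * cnj (z ^ n))))"
    unfolding fock_inner_def by (simp add: sum_distrib_right mult.assoc del: complex_cnj_power)
  also have "\<dots> = (\<Sum>k\<in>A. b k * fock_inner \<alpha> m (\<lambda>z. z ^ k) (\<lambda>z. z ^ n))"
    by (subst Bochner_Integration.integral_sum) (use int in \<open>auto simp: fock_inner_def simp del: complex_cnj_power\<close>)
  also have "\<dots> = b n * fock_moment n"
    using assms by (simp add: fock_inner_power_power if_distrib cong: if_cong)
  finally show ?thesis using fock_moment_pos[of n] by simp
qed

lemma fock_norm_squared_eq_inner: "of_real ((fock_norm \<alpha> m f)\<^sup>2) = fock_inner \<alpha> m f f"
  unfolding fock_norm_squared fock_inner_def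
  by (simp add: complex_norm_square flip: integral_complex_of_real del: of_real_power)

lemma fock_norm_poly:
  assumes "finite A"
  shows "(fock_norm \<alpha> m (\<lambda>z. \<Sum>n\<in>A. b n * z ^ n))\<^sup>2 = (\<Sum>n\<in>A. (norm (b n))\<^sup>2 * fock_moment n)"
proof -
  have "complex_of_real ((fock_norm \<alpha> m (\<lambda>z. \<Sum>n\<in>A. b n * z ^ n))\<^sup>2) = of_real (\<Sum>n\<in>A. (norm (b n))\<^sup>2 * fock_moment n)"
    unfolding fock_norm_squared_eq_inner fock_inner_poly[OF fock_space_poly]
    using assms by (simp add: taylor_coeff_poly complex_norm_square mult_ac del: of_real_power)
  then show ?thesis by (simp only: of_real_eq_iff)
qed

lemma fock_norm_scale: "fock_norm \<alpha> m (\<lambda>z. k * f z) = norm k * fock_norm \<alpha> m f"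
  by (simp add: fock_norm_eq norm_mult power_mult_distrib real_sqrt_mult)

text \<open>Bessel's inequality for the orthogonal system of monomials: expand
  \<open>\<parallel>f - q\<parallel>\<^sup>2 \<ge> 0\<close> for the Taylor polynomial \<open>q\<close>.\<close>
lemma fock_Bessel:
  assumes f: "f \<in> fock_space \<alpha> m"
  shows "(\<Sum>n<M. (norm (taylor_coeff f n))\<^sup>2 * fock_moment n) \<le> (fock_norm \<alpha> m f)\<^sup>2"
proof -
  define q where "q = (\<lambda>z. \<Sum>n<M. taylor_coeff f n * z ^ n)"
  define S where "S = (\<Sum>n<M. (norm (taylor_coeff f n))\<^sup>2 * fock_moment n)"
  have q: "q \<in> fock_space \<alpha> m" unfolding q_def by (rule fock_space_poly)
  have qq: "(fock_norm \<alpha> m q)\<^sup>2 = S" unfolding q_def S_def by (rule fock_norm_poly) simp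
  have fq: "fock_inner \<alpha> m f q = of_real S"
    unfolding q_def S_def fock_inner_poly[OF f] by (simp add: complex_norm_square mult_ac del: of_real_power)
  have "0 \<le> (LINT z|fock_measure \<alpha> m. (norm (f z - q z))\<^sup>2)" by simp
  also have "\<dots> = (LINT z|fock_measure \<alpha> m. (norm (f z))\<^sup>2 - 2 * Re (f z * cnj (q z)) + (norm (q z))\<^sup>2)"
    by (intro Bochner_Integration.integral_cong refl)
       (simp add: cmod_power2, simp add: power2_eq_square algebra_simps)
  also have "\<dots> = (fock_norm \<alpha> m f)\<^sup>2 - 2 * Re (fock_inner \<alpha> m f q) + (fock_norm \<alpha> m q)\<^sup>2"
  proof -
    have 1: "integrable (fock_measure \<alpha> m) (\<lambda>z. (norm (f z))\<^sup>2)" "integrable (fock_measure \<alpha> m) (\<lambda>z. (norm (q z))\<^sup>2)"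
      using f q by (auto simp: fock_space_def)
    have 2: "integrable (fock_measure \<alpha> m) (\<lambda>z. f z * cnj (q z))"
      by (rule fock_inner_integrable[OF f q])
    have 3: "integrable (fock_measure \<alpha> m) (\<lambda>z. 2 * Re (f z * cnj (q z)))"
      by (intro integrable_mult_right integrable_Re 2)
    have 4: "(LINT z|fock_measure \<alpha> m. 2 * Re (f z * cnj (q z))) = 2 * Re (fock_inner \<alpha> m f q)"
      unfolding fock_inner_def by (simp only: integral_mult_right_zero integral_Re[OF 2])
    show ?thesis
      by (subst Bochner_Integration.integral_add, (intro Bochner_Integration.integrable_diff 1 3)+,
          subst Bochner_Integration.integral_diff, (intro 1 3)+)
         (simp only: fock_norm_squared 4)
  qed
  finally show ?thesis by (simp add: fq qq S_def)
qed

section \<open>The reproducing kernel on the diagonal\<close>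

text \<open>The reproducing kernel \<open>K w w\<close> as a function of \<open>r = \<bar>w\<bar>\<close>.\<close>
definition fock_kernel_diag :: "real \<Rightarrow> real" where
  "fock_kernel_diag r = (\<Sum>n. r ^ (2 * n) / fock_moment n)"

text \<open>The partial sums \<open>q\<close> of the kernel function at \<open>v\<close> reproduce evaluation at \<open>v\<close> on
  polynomials of degree below \<open>M\<close>; in particular \<open>q v = \<parallel>q\<parallel>\<^sup>2\<close>. The modulus is passed as
  a separate variable so that the lemma also applies to the real point \<open>r\<close>.\<close>
lemma truncated_kernel:
  fixes v :: complex and M :: nat
  assumes r: "r = norm v"
  defines "q \<equiv> \<lambda>z. \<Sum>n<M. (cnj v ^ n / fock_moment n) * z ^ n"
    and "S \<equiv> \<Sum>n<M. r ^ (2 * n) / fock_moment n"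
  shows "q \<in> fock_space \<alpha> m" "q v = of_real S" "(fock_norm \<alpha> m q)\<^sup>2 = S"
proof -
  show "q \<in> fock_space \<alpha> m" unfolding q_def by (rule fock_space_poly)
  have "cnj v ^ n * v ^ n = of_real (r ^ (2 * n))" for n
  proof -
    have "of_real (r ^ (2 * n)) = (of_real (r\<^sup>2) :: complex) ^ n" by (simp add: power_mult)
    also have "of_real (r\<^sup>2) = v * cnj v" unfolding r by (rule complex_norm_square)
    finally show ?thesis by (simp add: power_mult_distrib mult.commute)
  qed
  then show "q v = of_real S" unfolding q_def S_def by simp
  have "(norm (cnj v ^ n / fock_moment n))\<^sup>2 * fock_moment n = r ^ (2 * n) / fock_moment n" for n
    using fock_moment_pos[of n]
    by (simp add: r norm_divide norm_power power_divide power2_eq_square[of "fock_moment n"] mult.commute flip: power_mult)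
  then show "(fock_norm \<alpha> m q)\<^sup>2 = S"
    unfolding q_def S_def by (subst fock_norm_poly) auto
qed

text \<open>The partial sum \<open>S\<close> is both the value and the squared norm of a truncated kernel function, so
  the pointwise bound reads \<open>S\<^sup>2 \<le> C * S\<close> with \<open>C\<close> independent of the truncation.\<close>
lemma fock_kernel_diag_summable:
  assumes "r \<ge> 0"
  shows "summable (\<lambda>n. r ^ (2 * n) / fock_moment n)"
proof -
  obtain K where K0: "K > 0" and K: "\<And>f w. f \<in> fock_space \<alpha> m \<Longrightarrow>
     (norm (f w))\<^sup>2 \<le> K * exp (\<alpha> * (norm w + 1) powr m) * (fock_norm \<alpha> m f)\<^sup>2"
    using fock_pointwise_bound by metis
  define C where "C = K * exp (\<alpha> * (norm (complex_of_real r) + 1) powr m)"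
  have "(\<Sum>n<M. r ^ (2 * n) / fock_moment n) \<le> C" for M
  proof -
    define S where "S = (\<Sum>n<M. r ^ (2 * n) / fock_moment n)"
    have "S \<ge> 0"
      unfolding S_def using fock_moment_pos assms by (intro sum_nonneg divide_nonneg_pos) auto
    have r: "r = norm (complex_of_real r)" using assms by simp
    note q = truncated_kernel[OF r, of M, folded S_def]
    have "S\<^sup>2 \<le> C * S"
      using K[OF q(1), of "complex_of_real r"] unfolding q(2,3) C_def by simp
    moreover have "C \<ge> 0"
      using K0 by (simp add: C_def)
    ultimately show ?thesis
      unfolding S_def[symmetric] using \<open>S \<ge> 0\<close> by (cases "S = 0") (auto simp: power2_eq_square)
  qed
  then show ?thesis
    using fock_moment_pos assms
    by (intro bounded_imp_summable[where B=C]) (auto intro!: divide_nonneg_pos simp: lessThan_Suc_atMost[symmetric] simp del: sum.lessThan_Suc)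
qed

lemma fock_kernel_diag_pos: "r \<ge> 0 \<Longrightarrow> fock_kernel_diag r > 0"
proof -
  assume r: "r \<ge> 0"
  have "0 < r ^ (2 * 0) / fock_moment 0" using fock_moment_pos[of 0] by simp
  also have "\<dots> \<le> fock_kernel_diag r"
    unfolding fock_kernel_diag_def
    using sum_le_suminf[OF fock_kernel_diag_summable[OF r], of "{0}"] fock_moment_pos
    by (simp add: less_imp_le)
  finally show ?thesis .
qed

lemma fock_kernel_diag_mono:
  assumes "0 \<le> r" "r \<le> s"
  shows "fock_kernel_diag r \<le> fock_kernel_diag s"
  unfolding fock_kernel_diag_def
  using assms fock_moment_pos
  by (intro suminf_le fock_kernel_diag_summable divide_right_mono power_mono) (auto simp: less_imp_le)

lemma fock_Bessel_summable:
  assumes f: "f \<in> fock_space \<alpha> m"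
  shows "summable (\<lambda>n. (norm (taylor_coeff f n))\<^sup>2 * fock_moment n)"
    and "(\<Sum>n. (norm (taylor_coeff f n))\<^sup>2 * fock_moment n) \<le> (fock_norm \<alpha> m f)\<^sup>2"
proof -
  show s: "summable (\<lambda>n. (norm (taylor_coeff f n))\<^sup>2 * fock_moment n)"
    using fock_Bessel[OF f, of "Suc _"] less_imp_le[OF fock_moment_pos]
    by (intro bounded_imp_summable[where B="(fock_norm \<alpha> m f)\<^sup>2"])
       (auto intro!: mult_nonneg_nonneg simp: lessThan_Suc_atMost[symmetric] simp del: sum.lessThan_Suc)
  show "(\<Sum>n. (norm (taylor_coeff f n))\<^sup>2 * fock_moment n) \<le> (fock_norm \<alpha> m f)\<^sup>2"
    by (rule suminf_le_const[OF s fock_Bessel[OF f]])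
qed

text \<open>Cauchy-Schwarz for the Taylor series from degree \<open>M\<close> on, weighted by the moments. For
  \<open>M = 0\<close> it bounds the evaluation functional; for large \<open>M\<close> the first factor is small.\<close>
lemma fock_tail_bound:
  assumes f: "f \<in> fock_space \<alpha> m"
  shows "(norm (f w - (\<Sum>n<M. taylor_coeff f n * w ^ n)))\<^sup>2
    \<le> (\<Sum>n. (norm (taylor_coeff f (n + M)))\<^sup>2 * fock_moment (n + M)) * fock_kernel_diag (norm w)"
    (is "_ \<le> ?\<tau> * _")
proof -
  have hol: "f holomorphic_on UNIV" using f by (simp add: fock_space_def)
  have lim: "(\<lambda>L. (norm (\<Sum>n<L. taylor_coeff f (n + M) * w ^ (n + M)))\<^sup>2)
      \<longlonglongrightarrow> (norm (f w - (\<Sum>n<M. taylor_coeff f n * w ^ n)))\<^sup>2"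
    using sums_split_initial_segment[OF taylor_coeff_sums[OF hol, of w], of M]
    unfolding sums_def by (intro tendsto_intros)
  show ?thesis
  proof (rule LIMSEQ_le_const2[OF lim], intro exI allI impI)
    fix L
    define x where "x = (\<lambda>n. norm (taylor_coeff f (n + M)) * sqrt (fock_moment (n + M)))"
    define y where "y = (\<lambda>n. norm w ^ (n + M) / sqrt (fock_moment (n + M)))"
    have "norm (\<Sum>n<L. taylor_coeff f (n + M) * w ^ (n + M)) \<le> (\<Sum>n<L. x n * y n)"
      unfolding x_def y_def using fock_moment_pos
      by (intro sum_norm_le) (simp add: norm_mult norm_power less_imp_neq[THEN not_sym])
    then have "(norm (\<Sum>n<L. taylor_coeff f (n + M) * w ^ (n + M)))\<^sup>2 \<le> (\<Sum>n<L. x n * y n)\<^sup>2"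
      by (intro power_mono) auto
    also have "\<dots> \<le> (\<Sum>n<L. (x n)\<^sup>2) * (\<Sum>n<L. (y n)\<^sup>2)"
      by (rule Cauchy_Schwarz_ineq_sum)
    also have "\<dots> \<le> ?\<tau> * fock_kernel_diag (norm w)"
    proof (rule mult_mono)
      have x2: "(x n)\<^sup>2 = (norm (taylor_coeff f (n + M)))\<^sup>2 * fock_moment (n + M)" for n
        using fock_moment_pos[of "n + M"] by (simp add: x_def power_mult_distrib)
      have sx: "summable (\<lambda>n. (x n)\<^sup>2)"
        unfolding x2 by (rule summable_ignore_initial_segment[OF fock_Bessel_summable(1)[OF f]])
      have "(\<Sum>n<L. (x n)\<^sup>2) \<le> (\<Sum>n. (x n)\<^sup>2)" by (intro sum_le_suminf sx) auto
      then show "(\<Sum>n<L. (x n)\<^sup>2) \<le> ?\<tau>" by (simp only: x2)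
      have "0 \<le> (\<Sum>n. (x n)\<^sup>2)" by (intro suminf_nonneg sx) auto
      then show "0 \<le> ?\<tau>" by (simp only: x2)
      have y2: "(y n)\<^sup>2 = norm w ^ (2 * (n + M)) / fock_moment (n + M)" for n
        using fock_moment_pos[of "n + M"] by (simp add: y_def power_divide mult.commute flip: power_mult)
      have "(\<Sum>n<L. (y n)\<^sup>2) = (\<Sum>k\<in>{M..<L + M}. norm w ^ (2 * k) / fock_moment k)"
        using sum.shift_bounds_nat_ivl[of "\<lambda>k. norm w ^ (2 * k) / fock_moment k" 0 M L] by (simp add: y2 lessThan_atLeast0)
      also have "\<dots> \<le> fock_kernel_diag (norm w)"
        unfolding fock_kernel_diag_def using fock_moment_pos
        by (intro sum_le_suminf fock_kernel_diag_summable) (auto intro!: divide_nonneg_pos)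
      finally show "(\<Sum>n<L. (y n)\<^sup>2) \<le> fock_kernel_diag (norm w)" .
      show "0 \<le> (\<Sum>n<L. (y n)\<^sup>2)" by (intro sum_nonneg) auto
    qed
    finally show "(norm (\<Sum>n<L. taylor_coeff f (n + M) * w ^ (n + M)))\<^sup>2 \<le> ?\<tau> * fock_kernel_diag (norm w)" .
  qed
qed

lemma fock_evaluation_bound:
  assumes f: "f \<in> fock_space \<alpha> m"
  shows "(norm (f w))\<^sup>2 \<le> (fock_norm \<alpha> m f)\<^sup>2 * fock_kernel_diag (norm w)"
proof -
  have "(norm (f w))\<^sup>2 \<le> (\<Sum>n. (norm (taylor_coeff f n))\<^sup>2 * fock_moment n) * fock_kernel_diag (norm w)"
    using fock_tail_bound[OF f, of w 0] by simp
  also have "\<dots> \<le> (fock_norm \<alpha> m f)\<^sup>2 * fock_kernel_diag (norm w)"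
    using fock_Bessel_summable(2)[OF f] fock_kernel_diag_pos[of "norm w"]
    by (intro mult_right_mono) auto
  finally show ?thesis .
qed

text \<open>The kernel series contains a term of degree \<open>2 * Suc n\<close>.\<close>
lemma power_little_o_kernel:
  "((\<lambda>w::complex. norm w ^ n / sqrt (fock_kernel_diag (norm w))) \<longlongrightarrow> 0) at_infinity"
proof (rule Lim_null_comparison)
  define C where "C = sqrt (fock_moment (Suc n))"
  have C: "C > 0" using fock_moment_pos by (simp add: C_def)
  show "\<forall>\<^sub>F w::complex in at_infinity. norm (norm w ^ n / sqrt (fock_kernel_diag (norm w))) \<le> C * inverse (norm w)"
    unfolding eventually_at_infinity
  proof (intro exI allI impI)
    fix w :: complex assume w: "1 \<le> norm w"
    have k: "fock_kernel_diag (norm w) > 0" by (rule fock_kernel_diag_pos) simp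
    have "norm w ^ (2 * Suc n) / fock_moment (Suc n) \<le> fock_kernel_diag (norm w)"
      unfolding fock_kernel_diag_def
      using sum_le_suminf[OF fock_kernel_diag_summable, of "norm w" "{Suc n}"] fock_moment_pos
      by (simp add: divide_nonneg_pos)
    moreover have "(norm w ^ Suc n)\<^sup>2 = norm w ^ (2 * Suc n)"
      by (simp only: power_mult[symmetric] mult.commute)
    ultimately have "sqrt ((norm w ^ Suc n)\<^sup>2) \<le> sqrt (fock_moment (Suc n) * fock_kernel_diag (norm w))"
      using fock_moment_pos[of "Suc n"] by (intro real_sqrt_le_mono) (simp only: pos_divide_le_eq mult.commute)
    then have "norm w * norm w ^ n \<le> C * sqrt (fock_kernel_diag (norm w))"
      by (simp add: C_def real_sqrt_mult)
    then have "norm w ^ n / sqrt (fock_kernel_diag (norm w)) \<le> C / norm w"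
      using w k by (subst pos_le_divide_eq, fastforce) (simp add: pos_divide_le_eq mult.commute)
    then show "norm (norm w ^ n / sqrt (fock_kernel_diag (norm w))) \<le> C * inverse (norm w)"
      using k by (simp add: divide_inverse)
  qed
  show "((\<lambda>w::complex. C * inverse (norm w)) \<longlongrightarrow> 0) at_infinity"
    by (intro tendsto_mult_right_zero tendsto_inverse_0_at_top filterlim_norm_at_top)
qed

text \<open>Up to an arbitrarily small multiple of the root of the kernel, \<open>f\<close> is a polynomial, and polynomials are negligible against the kernel. In terms of the Hilbert space: the normalized
  kernel functions tend weakly to zero at infinity.\<close>
lemma fock_little_o_kernel:
  assumes f: "f \<in> fock_space \<alpha> m"
  shows "((\<lambda>w. norm (f w) / sqrt (fock_kernel_diag (norm w))) \<longlongrightarrow> 0) at_infinity"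
proof (rule tendstoI)
  fix e :: real assume e: "e > 0"
  have "(\<lambda>M. \<Sum>n. (norm (taylor_coeff f (n + M)))\<^sup>2 * fock_moment (n + M)) \<longlonglongrightarrow> 0"
    by (rule suminf_exist_split2[OF fock_Bessel_summable(1)[OF f]])
  then have "\<forall>\<^sub>F M in sequentially. (\<Sum>n. (norm (taylor_coeff f (n + M)))\<^sup>2 * fock_moment (n + M)) < (e/2)\<^sup>2"
    using e by (intro order_tendstoD) auto
  then obtain M where M: "(\<Sum>n. (norm (taylor_coeff f (n + M)))\<^sup>2 * fock_moment (n + M)) < (e/2)\<^sup>2"
    by (auto simp: eventually_sequentially)
  have "((\<lambda>w::complex. \<Sum>n<M. norm (taylor_coeff f n) * (norm w ^ n / sqrt (fock_kernel_diag (norm w)))) \<longlongrightarrow> 0) at_infinity"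
    by (intro tendsto_null_sum tendsto_mult_right_zero power_little_o_kernel)
  then have "\<forall>\<^sub>F w::complex in at_infinity. (\<Sum>n<M. norm (taylor_coeff f n) * (norm w ^ n / sqrt (fock_kernel_diag (norm w)))) < e/2"
    using e by (intro order_tendstoD) auto
  then show "\<forall>\<^sub>F w in at_infinity. dist (norm (f w) / sqrt (fock_kernel_diag (norm w))) 0 < e"
  proof eventually_elim
    case (elim w)
    define N where "N = sqrt (fock_kernel_diag (norm w))"
    have k: "fock_kernel_diag (norm w) > 0" by (rule fock_kernel_diag_pos) simp
    then have N: "N > 0" "N\<^sup>2 = fock_kernel_diag (norm w)" by (auto simp: N_def)
    let ?p = "\<Sum>n<M. taylor_coeff f n * w ^ n"
    have "(norm (f w - ?p))\<^sup>2 \<le> (e/2)\<^sup>2 * N\<^sup>2"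
      unfolding N(2)
      by (rule order_trans[OF fock_tail_bound[OF f, of w M] mult_right_mono[OF less_imp_le[OF M] less_imp_le[OF k]]])
    then have "(norm (f w - ?p))\<^sup>2 \<le> (e/2 * N)\<^sup>2"
      by (simp only: power_mult_distrib[symmetric])
    then have "norm (f w - ?p) \<le> e/2 * N"
      by (rule power2_le_imp_le) (use e N(1) in simp)
    moreover have "norm ?p \<le> (\<Sum>n<M. norm (taylor_coeff f n) * norm w ^ n)"
      by (rule sum_norm_le) (simp add: norm_mult norm_power)
    moreover have "(\<Sum>n<M. norm (taylor_coeff f n) * norm w ^ n) < e/2 * N"
    proof -
      have "(\<Sum>n<M. norm (taylor_coeff f n) * norm w ^ n) / N < e/2"
        using elim unfolding sum_divide_distrib by (simp add: N_def)
      then show ?thesis using N(1) by (simp only: pos_divide_less_eq)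
    qed
    moreover have "norm (f w) \<le> norm (f w - ?p) + norm ?p"
      by (metis diff_add_cancel norm_triangle_ineq)
    ultimately have "norm (f w) < e * N" by linarith
    then have "norm (f w) / N < e" using N(1) by (simp only: pos_divide_less_eq)
    then show ?case using N(1) by (simp add: N_def)
  qed
qed

text \<open>A normalized truncation of the kernel function, long enough to carry a quarter of
  its total.\<close>
lemma near_extremal:
  "\<exists>f\<in>fock_space \<alpha> m. fock_norm \<alpha> m f \<le> 1 \<and> sqrt (fock_kernel_diag (norm v)) / 2 \<le> norm (f v)"
proof -
  define k where "k = fock_kernel_diag (norm v)"
  have k: "k > 0" unfolding k_def by (rule fock_kernel_diag_pos) simp
  have "(\<lambda>M. \<Sum>n<M. norm v ^ (2 * n) / fock_moment n) \<longlonglongrightarrow> k"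
    using summable_LIMSEQ[OF fock_kernel_diag_summable[of "norm v"]] by (simp add: k_def fock_kernel_diag_def)
  then have "\<forall>\<^sub>F M in sequentially. k / 4 < (\<Sum>n<M. norm v ^ (2 * n) / fock_moment n)"
    using k by (intro order_tendstoD) auto
  then obtain M where M: "k / 4 < (\<Sum>n<M. norm v ^ (2 * n) / fock_moment n)"
    by (auto simp: eventually_sequentially)
  define S where "S = (\<Sum>n<M. norm v ^ (2 * n) / fock_moment n)"
  define q where "q = (\<lambda>z. \<Sum>n<M. (cnj v ^ n / fock_moment n) * z ^ n)"
  note q = truncated_kernel[OF refl, of v M, folded S_def q_def]
  have qv: "q v = of_real S" unfolding q_def by (rule q(2))
  have S: "S > 0" "sqrt k / 2 \<le> sqrt S"
    using M k real_sqrt_le_mono[of "k/4" S] by (auto simp: S_def real_sqrt_divide)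
  have nq: "fock_norm \<alpha> m q = sqrt S"
    using q(3) fock_norm_nonneg[of q] by (metis real_sqrt_unique)
  show ?thesis
  proof (intro bexI conjI)
    show "(\<lambda>z. of_real (inverse (sqrt S)) * q z) \<in> fock_space \<alpha> m"
      by (rule fock_space_scale[OF q(1)])
    show "fock_norm \<alpha> m (\<lambda>z. of_real (inverse (sqrt S)) * q z) \<le> 1"
      unfolding fock_norm_scale nq using S by (simp add: norm_inverse)
    have "norm (of_real (inverse (sqrt S)) * q v) = \<bar>inverse (sqrt S)\<bar> * \<bar>S\<bar>"
      by (simp only: norm_mult norm_of_real qv)
    also have "\<dots> = S / sqrt S"
      using S(1) by (simp add: divide_inverse)
    also have "\<dots> = sqrt S"
      using S(1) by (intro real_div_sqrt) simp
    finally have "norm (of_real (inverse (sqrt S)) * q v) = sqrt S" .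
    then show "sqrt (fock_kernel_diag (norm v)) / 2 \<le> norm (of_real (inverse (sqrt S)) * q v)"
      using S by (simp add: k_def)
  qed
qed

section \<open>Contractive symbols give compact operators\<close>

text \<open>For suitable \<open>B\<close> this growth class contains a given ball of the Fock space. It is stable under
  the limits that Montel's theorem produces, and the operators with contractive symbol treated below map it
  into the Fock space; so the limit of a bounded sequence stays within their reach.\<close>
definition growth_bounded :: "real \<Rightarrow> (complex \<Rightarrow> complex) \<Rightarrow> bool" where
  "growth_bounded B f \<longleftrightarrow> f holomorphic_on UNIV \<and> (\<forall>w. (norm (f w))\<^sup>2 \<le> B * exp (\<alpha> * (norm w + 1) powr m))"

text \<open>The dominating function is independent of \<open>f\<close> and \<open>B\<close>. It is the square of
  \<open>c * exp (\<bar>d\<bar> * \<bar>z\<bar>)\<close> times the growth bound for \<open>B = 1\<close> at modulus \<open>\<bar>a\<bar> + \<bar>l\<bar> * \<bar>z\<bar>\<close>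
  times the weight.\<close>
lemma weighted_composition_dominated:
  assumes l: "norm l < 1" and d: "d = 0 \<or> m > 1"
  shows "\<exists>D. integrable lborel D \<and> (\<forall>B f z. growth_bounded B f \<longrightarrow>
     fock_weight \<alpha> m z * (norm (c * exp (d * z) * f (a + l * z)))\<^sup>2 \<le> B * D z)"
proof -
  define \<kappa> where "\<kappa> = m * \<alpha> powr (2 / m) / (2 * pi * Gamma (2 / m))"
  have \<kappa>: "\<kappa> > 0" using fock_constant_pos[OF \<alpha> m] by (simp add: \<kappa>_def)
  define h where "h = (\<lambda>t. exp (2 * norm d * t + \<alpha> * ((norm a + 1) + norm l * t) powr m - \<alpha> * t powr m))"
  obtain K where K: "\<And>t. t \<ge> 0 \<Longrightarrow> h t \<le> K / (1 + t) ^ 4"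
    using dominating_weight_decay[OF \<alpha> m, of "2 * norm d" "norm l" "norm a + 1"] l d
    unfolding h_def by (auto simp: add_nonneg_pos)
  define D where "D = (\<lambda>z::complex. \<kappa> * (norm c)\<^sup>2 * h (norm z))"
  show ?thesis
  proof (intro exI conjI allI impI)
    show "integrable lborel D"
    proof (rule integrable_decay_complex)
      show "D \<in> borel_measurable lborel" unfolding D_def h_def by measurable
      fix z
      have "norm (D z) = \<kappa> * (norm c)\<^sup>2 * h (norm z)"
        using \<kappa> by (simp add: D_def h_def abs_mult)
      also have "\<dots> \<le> \<kappa> * (norm c)\<^sup>2 * (K / (1 + norm z) ^ 4)"
        using \<kappa> by (intro mult_left_mono K) auto
      finally show "norm (D z) \<le> (\<kappa> * (norm c)\<^sup>2 * K) / (1 + norm z) ^ 4" by simp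
    qed
    fix B f z assume gb: "growth_bounded B f"
    have B: "B \<ge> 0"
    proof -
      have "0 \<le> B * exp (\<alpha> * (norm (0::complex) + 1) powr m)"
        using gb unfolding growth_bounded_def by (meson order_trans zero_le_power2)
      then show ?thesis by (simp add: zero_le_mult_iff)
    qed
    have "(norm (f (a + l * z)))\<^sup>2 \<le> B * exp (\<alpha> * (norm (a + l * z) + 1) powr m)"
      using gb by (simp add: growth_bounded_def)
    also have "\<dots> \<le> B * exp (\<alpha> * ((norm a + 1) + norm l * norm z) powr m)"
    proof -
      have "norm (a + l * z) + 1 \<le> (norm a + 1) + norm l * norm z"
        using norm_triangle_ineq[of a "l * z"] by (simp add: norm_mult)
      then have "(norm (a + l * z) + 1) powr m \<le> ((norm a + 1) + norm l * norm z) powr m"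
        using m by (intro powr_mono2) auto
      then show ?thesis using B \<alpha> by (intro mult_left_mono) auto
    qed
    finally have 1: "(norm (f (a + l * z)))\<^sup>2 \<le> B * exp (\<alpha> * ((norm a + 1) + norm l * norm z) powr m)" .
    have "Re (d * z) \<le> norm d * norm z" by (metis complex_Re_le_cmod norm_mult)
    then have "(norm (exp (d * z)))\<^sup>2 \<le> (exp (norm d * norm z))\<^sup>2"
      by (intro power_mono) (auto simp: norm_exp_eq_Re)
    also have "\<dots> = exp (2 * norm d * norm z)" by (simp add: exp_double[symmetric] mult.assoc)
    finally have 2: "(norm (exp (d * z)))\<^sup>2 \<le> exp (2 * norm d * norm z)" .
    have "fock_weight \<alpha> m z * (norm (c * exp (d * z) * f (a + l * z)))\<^sup>2
        = (\<kappa> * (norm c)\<^sup>2 * exp (- \<alpha> * norm z powr m)) * ((norm (exp (d * z)))\<^sup>2 * (norm (f (a + l * z)))\<^sup>2)"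
      by (simp add: fock_weight_def \<kappa>_def norm_mult power_mult_distrib)
    also have "\<dots> \<le> (\<kappa> * (norm c)\<^sup>2 * exp (- \<alpha> * norm z powr m)) *
        (exp (2 * norm d * norm z) * (B * exp (\<alpha> * ((norm a + 1) + norm l * norm z) powr m)))"
      using \<kappa> by (intro mult_left_mono mult_mono 1 2) auto
    also have "\<dots> = B * D z"
      by (simp add: D_def h_def exp_add exp_diff exp_minus divide_inverse)
    finally show "fock_weight \<alpha> m z * (norm (c * exp (d * z) * f (a + l * z)))\<^sup>2 \<le> B * D z" .
  qed
qed

lemma growth_bounded_subsequence:
  assumes F: "\<And>n. growth_bounded B (F n)"
  obtains g r where "growth_bounded B g" "strict_mono (r :: nat \<Rightarrow> nat)" "\<And>z. (\<lambda>n. F (r n) z) \<longlonglongrightarrow> g z"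
proof -
  obtain g r where g: "g holomorphic_on UNIV" and r: "strict_mono (r :: nat \<Rightarrow> nat)"
    and lim: "\<And>z. z \<in> UNIV \<Longrightarrow> (\<lambda>n. F (r n) z) \<longlonglongrightarrow> g z"
  proof (rule Montel[of UNIV "Collect (growth_bounded B)" F])
    show "h holomorphic_on UNIV" if "h \<in> Collect (growth_bounded B)" for h
      using that by (simp add: growth_bounded_def)
    show "range F \<subseteq> Collect (growth_bounded B)" using F by auto
    fix K :: "complex set" assume "compact K"
    then obtain R where R: "\<And>z. z \<in> K \<Longrightarrow> norm z \<le> R"
      using compact_imp_bounded bounded_iff by metis
    show "\<exists>C. \<forall>h\<in>Collect (growth_bounded B). \<forall>z\<in>K. norm (h z) \<le> C"
    proof (intro exI ballI)
      fix h z assume h: "h \<in> Collect (growth_bounded B)" and z: "z \<in> K"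
      then have 1: "(norm (h z))\<^sup>2 \<le> B * exp (\<alpha> * (norm z + 1) powr m)"
        by (simp add: growth_bounded_def)
      have B: "B \<ge> 0"
        using order_trans[OF zero_le_power2 1] by (simp add: zero_le_mult_iff)
      note 1
      also have "B * exp (\<alpha> * (norm z + 1) powr m) \<le> B * exp (\<alpha> * (R + 1) powr m)"
        using B \<alpha> m R[OF z] by (intro mult_left_mono) (auto intro!: powr_mono2)
      finally show "norm (h z) \<le> sqrt (B * exp (\<alpha> * (R + 1) powr m))"
        by (rule real_le_rsqrt)
    qed
  qed auto
  have "growth_bounded B g"
    unfolding growth_bounded_def
  proof (intro conjI allI)
    fix w
    have "(\<lambda>n. (norm (F (r n) w))\<^sup>2) \<longlonglongrightarrow> (norm (g w))\<^sup>2"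
      by (intro tendsto_intros lim) auto
    then show "(norm (g w))\<^sup>2 \<le> B * exp (\<alpha> * (norm w + 1) powr m)"
      by (rule LIMSEQ_le_const2) (use F in \<open>auto simp: growth_bounded_def\<close>)
  qed fact
  then show thesis using that r lim by simp
qed

lemma fock_growth_bounded:
  "\<exists>K\<ge>0. \<forall>f\<in>fock_space \<alpha> m. growth_bounded (K * (fock_norm \<alpha> m f)\<^sup>2) f"
proof -
  obtain K where "K > 0" "\<And>f w. f \<in> fock_space \<alpha> m \<Longrightarrow>
     (norm (f w))\<^sup>2 \<le> K * exp (\<alpha> * (norm w + 1) powr m) * (fock_norm \<alpha> m f)\<^sup>2"
    using fock_pointwise_bound by metis
  then show ?thesis
    by (intro exI[of _ K]) (auto simp: growth_bounded_def fock_space_def mult_ac)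
qed

lemma growth_bounded_mono: "growth_bounded B f \<Longrightarrow> B \<le> C \<Longrightarrow> growth_bounded C f"
  unfolding growth_bounded_def by (meson exp_ge_zero mult_right_mono order_trans)

text \<open>Montel's theorem yields pointwise convergence along a subsequence, and the common integrable bound
  turns it into convergence in norm of the images.\<close>
lemma compact_weighted_composition:
  assumes l: "norm l < 1" and d: "d = 0 \<or> m > 1"
  shows "compact_on_fock \<alpha> m (weighted_composition (\<lambda>z. c * exp (d * z)) (\<lambda>z. a + l * z))"
proof -
  let ?T = "weighted_composition (\<lambda>z. c * exp (d * z)) (\<lambda>z. a + l * z)"
  obtain D where D: "integrable lborel D" and dom: "\<And>B f z. growth_bounded B f \<Longrightarrow>
     fock_weight \<alpha> m z * (norm (?T f z))\<^sup>2 \<le> B * D z"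
    using weighted_composition_dominated[OF l d, of c a] unfolding weighted_composition_def by auto
  obtain K where K: "K \<ge> 0" "\<And>f. f \<in> fock_space \<alpha> m \<Longrightarrow> growth_bounded (K * (fock_norm \<alpha> m f)\<^sup>2) f"
    using fock_growth_bounded by auto
  have hol: "?T f holomorphic_on UNIV" if "growth_bounded B f" for B f
  proof -
    have f: "f holomorphic_on UNIV" using that by (simp add: growth_bounded_def)
    show ?thesis unfolding weighted_composition_def
      by (intro holomorphic_intros holomorphic_on_compose_gen[OF _ f, unfolded o_def]) auto
  qed
  have maps: "?T f \<in> fock_space \<alpha> m" if f: "growth_bounded B f" for B f
    by (rule fock_spaceI_dominated[OF hol[OF f] _ dom[OF f]]) (use D in simp)
  show ?thesis
    unfolding compact_on_fock_def
  proof (intro conjI ballI allI impI)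
    show "?T f \<in> fock_space \<alpha> m" if "f \<in> fock_space \<alpha> m" for f
      using maps K(2)[OF that] by blast
    show "?T (\<lambda>z. f z + g z) = (\<lambda>z. ?T f z + ?T g z)" for f g
      by (simp add: weighted_composition_def algebra_simps)
    show "?T (\<lambda>z. k * f z) = (\<lambda>z. k * ?T f z)" for k f
      by (simp add: weighted_composition_def algebra_simps)
    fix F :: "nat \<Rightarrow> complex \<Rightarrow> complex"
    assume F: "(\<forall>n. F n \<in> fock_space \<alpha> m) \<and> (\<exists>B. \<forall>n. fock_norm \<alpha> m (F n) \<le> B)"
    then obtain B0 where B0: "\<And>n. fock_norm \<alpha> m (F n) \<le> B0" by blast
    define B where "B = K * B0\<^sup>2"
    have gF: "growth_bounded B (F n)" for n
    proof -
      have "K * (fock_norm \<alpha> m (F n))\<^sup>2 \<le> B"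
        unfolding B_def using K(1) B0[of n] fock_norm_nonneg by (intro mult_left_mono power_mono)
      then show ?thesis using K(2)[of "F n"] F growth_bounded_mono by blast
    qed
    obtain g r where g: "growth_bounded B g" and r: "strict_mono (r :: nat \<Rightarrow> nat)"
      and lim: "\<And>z. (\<lambda>n. F (r n) z) \<longlonglongrightarrow> g z"
      using growth_bounded_subsequence[of B F, OF gF] by blast
    have [measurable]: "?T g \<in> borel_measurable borel" "?T (F n) \<in> borel_measurable borel" for n
      using hol[OF g] hol[OF gF] by (auto intro: entire_measurable)
    let ?d = "\<lambda>n z. fock_weight \<alpha> m z *\<^sub>R (norm (?T (F (r n)) z - ?T g z))\<^sup>2"
    have "(\<lambda>n. LBINT z. ?d n z) \<longlonglongrightarrow> (LBINT z::complex. 0)"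
    proof (rule integral_dominated_convergence[where w="\<lambda>z. 4 * B * D z"])
      show "integrable lborel (\<lambda>z. 4 * B * D z)" using D by simp
      show "AE z in lborel. (\<lambda>n. ?d n z) \<longlonglongrightarrow> 0"
      proof (rule AE_I2)
        fix z
        have "(\<lambda>n. ?d n z) \<longlonglongrightarrow> fock_weight \<alpha> m z *\<^sub>R (norm (?T g z - ?T g z))\<^sup>2"
          unfolding weighted_composition_def by (intro tendsto_intros lim)
        then show "(\<lambda>n. ?d n z) \<longlonglongrightarrow> 0" by simp
      qed
      show "AE z in lborel. norm (?d n z) \<le> 4 * B * D z" for n
      proof (rule AE_I2)
        fix z
        have le: "(norm (x - y))\<^sup>2 \<le> 2 * (norm x)\<^sup>2 + 2 * (norm y)\<^sup>2" for x y :: complex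
          using norm_add_squared_le[of x "- y"] by simp
        have "norm (?d n z) \<le> fock_weight \<alpha> m z * (2 * (norm (?T (F (r n)) z))\<^sup>2 + 2 * (norm (?T g z))\<^sup>2)"
          using fock_weight_nonneg[of z] by (simp add: mult_left_mono le)
        also have "\<dots> \<le> 4 * B * D z"
          using dom[OF gF, of z "r n"] dom[OF g, of z] by (simp add: algebra_simps)
        finally show "norm (?d n z) \<le> 4 * B * D z" .
      qed
    qed measurable
    then have "(\<lambda>n. sqrt (LBINT z. ?d n z)) \<longlonglongrightarrow> sqrt 0"
      by (intro tendsto_real_sqrt) simp
    moreover have "fock_norm \<alpha> m (\<lambda>z. ?T (F (r n)) z - ?T g z) = sqrt (LBINT z. ?d n z)" for n
      unfolding fock_norm_eq by (subst integral_fock_measure) auto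
    ultimately have "(\<lambda>n. fock_norm \<alpha> m (\<lambda>z. ?T (F (r n)) z - ?T g z)) \<longlonglongrightarrow> 0"
      by simp
    then show "\<exists>g\<in>fock_space \<alpha> m. \<exists>r :: nat \<Rightarrow> nat. strict_mono r \<and>
           (\<lambda>n. fock_norm \<alpha> m (\<lambda>z. ?T (F (r n)) z - g z)) \<longlonglongrightarrow> 0"
      using maps[OF g] r by blast
  qed
qed

section \<open>Necessity of the conditions on the symbols\<close>

text \<open>In the direction where \<open>d * w\<close> is positive, \<open>exp (2 * Re (d * w))\<close> is exponential in
  \<open>\<bar>w\<bar>\<close>, while the pointwise bound allows only \<open>exp (O (\<bar>w\<bar> powr m))\<close>.\<close>
lemma exp_linear_in_fock_imp_constant:
  assumes m1: "m < 1" and c: "c \<noteq> 0" and mem: "(\<lambda>z. c * exp (d * z)) \<in> fock_space \<alpha> m"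
  shows "d = 0"
proof (rule ccontr)
  assume "d \<noteq> 0"
  define p where "p = norm d"
  have p: "p > 0" using \<open>d \<noteq> 0\<close> by (simp add: p_def)
  obtain B where B: "growth_bounded B (\<lambda>z. c * exp (d * z))"
    using fock_growth_bounded mem by blast
  have "filterlim (\<lambda>t. exp (2 * t * p\<^sup>2 - \<alpha> * (t * p + 1) powr m)) at_top at_top"
    using p m m1 \<alpha> by real_asymp
  then have "\<forall>\<^sub>F t in at_top. exp (2 * t * p\<^sup>2 - \<alpha> * (t * p + 1) powr m) > B / (norm c)\<^sup>2"
    by (simp add: filterlim_at_top_dense)
  then have "\<forall>\<^sub>F t in at_top. exp (2 * t * p\<^sup>2 - \<alpha> * (t * p + 1) powr m) > B / (norm c)\<^sup>2 \<and> t \<ge> 0"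
    using eventually_ge_at_top[of 0] by eventually_elim simp
  then obtain t where t: "exp (2 * t * p\<^sup>2 - \<alpha> * (t * p + 1) powr m) > B / (norm c)\<^sup>2" "t \<ge> 0"
    using eventually_happens[of _ "at_top :: real filter"] by auto
  \<comment> \<open>The ray on which \<open>d * w\<close> is a positive real.\<close>
  define w where "w = of_real t * cnj d"
  have nw: "norm w = t * p" using t by (simp add: w_def p_def norm_mult)
  have "Re (d * w) = t * p\<^sup>2"
    by (simp add: w_def p_def cmod_power2, simp add: power2_eq_square algebra_simps)
  then have "(norm (exp (d * w)))\<^sup>2 = exp (2 * t * p\<^sup>2)"
    by (simp add: norm_exp_eq_Re exp_double[symmetric] mult.assoc)
  moreover have "(norm (c * exp (d * w)))\<^sup>2 \<le> B * exp (\<alpha> * (norm w + 1) powr m)"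
    using B by (simp add: growth_bounded_def)
  ultimately have "(norm c)\<^sup>2 * exp (2 * t * p\<^sup>2) \<le> B * exp (\<alpha> * (t * p + 1) powr m)"
    by (simp add: norm_mult power_mult_distrib nw)
  then have "exp (2 * t * p\<^sup>2) / exp (\<alpha> * (t * p + 1) powr m) \<le> B / (norm c)\<^sup>2"
    using c by (simp add: field_simps)
  then show False using t(1) by (simp add: exp_diff)
qed

text \<open>The images of near-extremal functions for the points \<open>a + l * w n\<close> keep a fixed fraction of the
  largest possible size at \<open>w n\<close>, which no single function of the space does as
  \<open>w n\<close> tends to infinity.\<close>
lemma compact_imp_contraction:
  assumes T: "compact_on_fock \<alpha> m (weighted_composition (\<lambda>z. c * exp (d * z)) (\<lambda>z. a + l * z))"
    and c: "c \<noteq> 0"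
  shows "norm l < 1"
proof (rule ccontr)
  assume "\<not> norm l < 1"
  then have l: "norm l \<ge> 1" by simp
  let ?T = "weighted_composition (\<lambda>z. c * exp (d * z)) (\<lambda>z. a + l * z)"
  define N where "N = (\<lambda>w::complex. sqrt (fock_kernel_diag (norm w)))"
  have N: "N w > 0" for w unfolding N_def using fock_kernel_diag_pos[of "norm w"] by simp
  obtain u where u: "u \<noteq> 0" "Re (cnj a * l * u) = 0" "Re (d * u) \<ge> 0"
  proof -
    \<comment> \<open>For \<open>a \<noteq> 0\<close> this is a direction in which \<open>l * w\<close> is orthogonal to \<open>a\<close>; one of
      \<open>v\<close> and \<open>- v\<close> makes \<open>Re (d * u)\<close> nonnegative.\<close>
    define v where "v = (if a = 0 then 1 else \<i> * cnj (cnj a * l))"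
    have "l \<noteq> 0" using l by auto
    then have v: "v \<noteq> 0" by (simp add: v_def)
    have "Re (b * (\<i> * cnj b)) = 0" for b by (simp add: mult.commute)
    then have Re_v: "Re (cnj a * l * v) = 0" unfolding v_def by (auto simp del: complex_cnj_mult)
    show thesis
      using that[of v] that[of "-v"] v Re_v by (cases "Re (d * v) \<ge> 0") auto
  qed
  define w where "w = (\<lambda>n. of_nat n * u)"
  have far: "norm (w n) \<le> norm (a + l * w n)" for n
  proof (rule power2_le_imp_le)
    have "Re (cnj a * (l * w n)) = real n * Re (cnj a * l * u)"
      by (simp add: w_def algebra_simps)
    then have zero: "Re (cnj a * (l * w n)) = 0" using u(2) by simp
    have "(norm (w n))\<^sup>2 \<le> (norm l)\<^sup>2 * (norm (w n))\<^sup>2"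
      using l by (simp add: mult_le_cancel_right1 one_le_power)
    also have "\<dots> \<le> (norm a)\<^sup>2 + 2 * Re (cnj a * (l * w n)) + (norm (l * w n))\<^sup>2"
      unfolding zero by (simp add: norm_mult power_mult_distrib)
    also have "\<dots> = (norm (a + l * w n))\<^sup>2"
      by (simp add: cmod_power2, simp add: power2_eq_square algebra_simps)
    finally show "(norm (w n))\<^sup>2 \<le> (norm (a + l * w n))\<^sup>2" .
  qed simp
  have big: "norm (c * exp (d * w n)) \<ge> norm c" for n
  proof -
    have "Re (d * w n) = real n * Re (d * u)" by (simp add: w_def algebra_simps)
    then have "norm (exp (d * w n)) \<ge> 1" using u(3) by (simp add: norm_exp_eq_Re)
    then show ?thesis by (simp add: norm_mult mult_le_cancel_left1)
  qed
  have "\<exists>f\<in>fock_space \<alpha> m. fock_norm \<alpha> m f \<le> 1 \<and> N (a + l * w n) / 2 \<le> norm (f (a + l * w n))" for n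
    unfolding N_def by (rule near_extremal)
  then obtain F where F: "\<And>n. F n \<in> fock_space \<alpha> m" "\<And>n. fock_norm \<alpha> m (F n) \<le> 1"
      "\<And>n. N (a + l * w n) / 2 \<le> norm (F n (a + l * w n))"
    by metis
  obtain g r where g: "g \<in> fock_space \<alpha> m" and r: "strict_mono (r :: nat \<Rightarrow> nat)"
    and lim: "(\<lambda>n. fock_norm \<alpha> m (\<lambda>z. ?T (F (r n)) z - g z)) \<longlonglongrightarrow> 0"
    using T F(1,2) unfolding compact_on_fock_def by meson
  define \<epsilon> where "\<epsilon> = (\<lambda>n. fock_norm \<alpha> m (\<lambda>z. ?T (F (r n)) z - g z))"
  \<comment> \<open>\<open>g\<close> differs from the image by at most \<open>\<epsilon> n * N\<close> at \<open>w (r n)\<close>, and the image is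
    at least \<open>norm c / 2 * N\<close> there because \<open>N\<close> increases with the modulus.\<close>
  have low: "norm c / 2 - \<epsilon> n \<le> norm (g (w (r n))) / N (w (r n))" for n
  proof -
    let ?w = "w (r n)"
    have "N ?w \<le> N (a + l * ?w)"
      unfolding N_def using far by (intro real_sqrt_le_mono fock_kernel_diag_mono) auto
    then have "norm c * (N ?w / 2) \<le> norm (c * exp (d * ?w)) * norm (F (r n) (a + l * ?w))"
      using F(3)[of "r n"] N[of ?w] big[of "r n"] by (intro mult_mono) auto
    then have 1: "norm c * (N ?w / 2) \<le> norm (?T (F (r n)) ?w)"
      by (simp add: weighted_composition_def norm_mult)
    have "(\<lambda>z. ?T (F (r n)) z - g z) \<in> fock_space \<alpha> m"
      using T F(1) g unfolding compact_on_fock_def by (intro fock_space_diff) auto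
    from fock_evaluation_bound[OF this, of ?w]
    have "(norm (?T (F (r n)) ?w - g ?w))\<^sup>2 \<le> (\<epsilon> n * N ?w)\<^sup>2"
      using fock_kernel_diag_pos[of "norm ?w"] by (simp add: \<epsilon>_def N_def power_mult_distrib)
    then have 2: "norm (?T (F (r n)) ?w - g ?w) \<le> \<epsilon> n * N ?w"
      by (rule power2_le_imp_le) (use N[of ?w] fock_norm_nonneg in \<open>simp add: \<epsilon>_def\<close>)
    have "norm (?T (F (r n)) ?w) \<le> norm (?T (F (r n)) ?w - g ?w) + norm (g ?w)"
      by (metis diff_add_cancel norm_triangle_ineq)
    with 1 2 have "(norm c / 2 - \<epsilon> n) * N ?w \<le> norm (g ?w)" by (simp add: algebra_simps)
    then show ?thesis using N[of ?w] by (simp add: pos_le_divide_eq)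
  qed
  have "filterlim (\<lambda>n. w (r n)) at_infinity sequentially"
  proof -
    have "filterlim (\<lambda>n. real (r n) * norm u) at_top sequentially"
      using u(1) filterlim_compose[OF filterlim_real_sequentially filterlim_subseq[OF r]]
      by (intro filterlim_at_top_mult_tendsto_pos[where c="norm u"]) auto
    then show ?thesis
      by (intro filterlim_norm_at_top_imp_at_infinity) (simp add: w_def norm_mult)
  qed
  then have "(\<lambda>n. norm (g (w (r n))) / N (w (r n))) \<longlonglongrightarrow> 0"
    using filterlim_compose[OF fock_little_o_kernel[OF g]] unfolding N_def by blast
  moreover have "(\<lambda>n. norm c / 2 - \<epsilon> n) \<longlonglongrightarrow> norm c / 2 - 0"
    unfolding \<epsilon>_def by (intro tendsto_diff tendsto_const lim)
  ultimately have "norm c / 2 - 0 \<le> 0"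
    by (intro LIMSEQ_le[of "\<lambda>n. norm c / 2 - \<epsilon> n" _ "\<lambda>n. norm (g (w (r n))) / N (w (r n))"]) (use low in auto)
  then show False using c by simp
qed

end

theorem proposition5p3:
  fixes \<alpha> m :: real and \<phi> \<psi> :: "complex \<Rightarrow> complex" and l c d :: complex
  assumes "\<alpha> > 0"
    and "\<And>z. \<phi> z = \<phi> 0 + l * z"
    and "\<And>z. \<psi> z = c * exp (d * z)"
    and "c \<noteq> 0"
  shows "(0 < m \<and> m < 1 \<longrightarrow>
           (compact_on_fock \<alpha> m (weighted_composition \<psi> \<phi>) \<longleftrightarrow> norm l < 1 \<and> d = 0)) \<and>
         (m > 1 \<longrightarrow>
           (compact_on_fock \<alpha> m (weighted_composition \<psi> \<phi>) \<longleftrightarrow> norm l < 1))"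
proof -
  define a where "a = \<phi> 0"
  have \<psi>: "\<psi> = (\<lambda>z. c * exp (d * z))" using assms(3) by (rule ext)
  have \<phi>: "\<phi> = (\<lambda>z. a + l * z)" unfolding a_def using assms(2) by (rule ext)
  let ?C = "compact_on_fock \<alpha> m (weighted_composition \<psi> \<phi>)"
  have contraction: "norm l < 1" if "m > 0" ?C
  proof -
    interpret fock_parameters \<alpha> m by standard (use assms that in auto)
    show ?thesis using compact_imp_contraction[OF that(2)[unfolded \<psi> \<phi>]] assms(4) by blast
  qed
  have compact: ?C if "m > 0" "norm l < 1" "d = 0 \<or> m > 1"
  proof -
    interpret fock_parameters \<alpha> m by standard (use assms that in auto)
    show ?thesis unfolding \<psi> \<phi> by (rule compact_weighted_composition) (use that in auto)
  qed
  have no_exponential: "d = 0" if "0 < m" "m < 1" ?C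
  proof -
    interpret fock_parameters \<alpha> m by standard (use assms that in auto)
    have "weighted_composition \<psi> \<phi> (\<lambda>z. z ^ 0) \<in> fock_space \<alpha> m"
      using that(3) fock_space_power[of 0] unfolding compact_on_fock_def by blast
    then show ?thesis
      using exp_linear_in_fock_imp_constant[OF that(2) assms(4)]
      by (simp add: weighted_composition_def \<psi>)
  qed
  show ?thesis using contraction compact no_exponential by fastforce
qed

end
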